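(* Let $R$ be a PI ring (a ring satisfying a polynomial identity). Let $\sigma$ be a locally torsion automorphism of $R$ and let $D$ be a $\sigma$-derivation on $R$. Then $J(R[x;\sigma,D])\cap R$ is a nil ideal of $R$.
   Context: Rings are associative and need not have an identity. For a ring $S$, $J(S)$ denotes its Jacobson radical. An automorphism $\sigma$ of $R$ is locally torsion if for every $a\in R$ there is an integer $n=n_a>0$ with $\sigma^n(a)=a$. A $\sigma$-derivation of $R$ is an additive map $D:R\to R$ with $D(ab)=\sigma(a)D(b)+D(a)b$ for all $a,b\in R$. The Ore extension $R[x;\sigma,D]$ is the ring of polynomials $a_nx^n+\dots+a_1x+a_0$ with $n\ge 0$ and $a_i\in R$, with the usual addition and with multiplication determined by $xa=\sigma(a)x+D(a)$ for $a\in R$; $R$ is identified with the constant polynomials. *)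

theory Defs
  imports Complex_Main "HOL-Computational_Algebra.Polynomial" "HOL-Library.Poly_Mapping"
begin

text \<open>
  The base ring is a type of class \<^class>\<open>ring\<close>: associative, not necessarily commutative,
  not necessarily with identity. The multiplication of an Ore extension depends on the maps
  \<open>\<sigma>\<close> and \<open>D\<close>, so it cannot be a class instance. Ring-theoretic notions needed for an Ore
  extension therefore take the multiplication as an explicit argument \<open>m\<close>; the additive
  structure is that of the type.
\<close>

section \<open>Ideals and the Jacobson radical\<close>

definition left_ideal :: "('b::ab_group_add \<Rightarrow> 'b \<Rightarrow> 'b) \<Rightarrow> 'b set \<Rightarrow> bool" where
  "left_ideal m I \<longleftrightarrow>
     0 \<in> I \<and> (\<forall>x\<in>I. \<forall>y\<in>I. x - y \<in> I) \<and> (\<forall>s. \<forall>x\<in>I. m s x \<in> I)"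

definition two_sided_ideal :: "('b::ab_group_add \<Rightarrow> 'b \<Rightarrow> 'b) \<Rightarrow> 'b set \<Rightarrow> bool" where
  "two_sided_ideal m I \<longleftrightarrow> left_ideal m I \<and> (\<forall>s. \<forall>x\<in>I. m x s \<in> I)"

definition maximal_left_ideal :: "('b::ab_group_add \<Rightarrow> 'b \<Rightarrow> 'b) \<Rightarrow> 'b set \<Rightarrow> bool" where
  "maximal_left_ideal m M \<longleftrightarrow>
     left_ideal m M \<and> M \<noteq> UNIV \<and> (\<forall>I. left_ideal m I \<longrightarrow> M \<subseteq> I \<longrightarrow> I = M \<or> I = UNIV)"

text \<open>Modular (also called regular) left ideals; every left ideal is modular if there is an identity.\<close>

definition modular_left_ideal :: "('b::ab_group_add \<Rightarrow> 'b \<Rightarrow> 'b) \<Rightarrow> 'b set \<Rightarrow> bool" where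
  "modular_left_ideal m I \<longleftrightarrow> left_ideal m I \<and> (\<exists>e. \<forall>x. m x e - x \<in> I)"

text \<open>
  For rings without identity, the Jacobson radical is the intersection of the modular maximal
  left ideals (the whole ring if there are none).
\<close>

definition jacobson_radical :: "('b::ab_group_add \<Rightarrow> 'b \<Rightarrow> 'b) \<Rightarrow> 'b set" where
  "jacobson_radical m = \<Inter> {M. maximal_left_ideal m M \<and> modular_left_ideal m M}"

text \<open>Here \<open>((*) a ^^ n) a\<close> is the power of \<open>a\<close> with exponent \<open>n + 1\<close>.\<close>

definition nilpotent_element :: "'a::ring \<Rightarrow> bool" where
  "nilpotent_element a \<longleftrightarrow> (\<exists>n. ((*) a ^^ n) a = 0)"

definition nil_ideal :: "'a::ring set \<Rightarrow> bool" where
  "nil_ideal I \<longleftrightarrow> two_sided_ideal (*) I \<and> (\<forall>a\<in>I. nilpotent_element a)"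


section \<open>Polynomial identities\<close>

definition int_scale :: "int \<Rightarrow> 'a::ab_group_add \<Rightarrow> 'a" where
  "int_scale k a = (if k \<ge> 0 then ((+) a ^^ nat k) 0 else - (((+) a ^^ nat (- k)) 0))"

text \<open>
  A noncommutative polynomial over the integers in the variables \<open>X\<^sub>0, X\<^sub>1, \<dots>\<close> is a finitely
  supported function from words to coefficients; the word \<open>[i, j, \<dots>]\<close> is the monomial
  \<open>X\<^sub>i X\<^sub>j \<dots>\<close>. As there need not be an identity, only polynomials without constant term are
  evaluated, so the value at the empty word is irrelevant.
\<close>

fun eval_word :: "(nat \<Rightarrow> 'a::ring) \<Rightarrow> nat list \<Rightarrow> 'a" where
  "eval_word v [] = 0"
| "eval_word v [i] = v i"
| "eval_word v (i # j # w) = v i * eval_word v (j # w)"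

definition eval_ncpoly :: "(nat \<Rightarrow> 'a::ring) \<Rightarrow> (nat list \<Rightarrow>\<^sub>0 int) \<Rightarrow> 'a" where
  "eval_ncpoly v f = (\<Sum>w\<in>Poly_Mapping.keys f. int_scale (Poly_Mapping.lookup f w) (eval_word v w))"

text \<open>
  A nonzero integer polynomial may have coefficients that annihilate the ring (for instance
  \<open>p X\<^sub>0\<close> in characteristic \<open>p\<close>). The usual convention for rings is therefore to require the
  identity to be monic: some monomial of highest degree has coefficient 1.
\<close>

definition monic_ncpoly :: "(nat list \<Rightarrow>\<^sub>0 int) \<Rightarrow> bool" where
  "monic_ncpoly f \<longleftrightarrow>
     (\<exists>w. Poly_Mapping.lookup f w = 1 \<and> (\<forall>u\<in>Poly_Mapping.keys f. length u \<le> length w))"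

definition pi_ring :: "'a::ring itself \<Rightarrow> bool" where
  "pi_ring _ \<longleftrightarrow>
     (\<exists>f. [] \<notin> Poly_Mapping.keys f \<and> monic_ncpoly f \<and>
          (\<forall>v :: nat \<Rightarrow> 'a. eval_ncpoly v f = 0))"


section \<open>Automorphisms and skew derivations\<close>

definition ring_automorphism :: "('a::ring \<Rightarrow> 'a) \<Rightarrow> bool" where
  "ring_automorphism \<sigma> \<longleftrightarrow>
     bij \<sigma> \<and> (\<forall>a b. \<sigma> (a + b) = \<sigma> a + \<sigma> b) \<and> (\<forall>a b. \<sigma> (a * b) = \<sigma> a * \<sigma> b)"

definition locally_torsion :: "('a \<Rightarrow> 'a) \<Rightarrow> bool" where
  "locally_torsion \<sigma> \<longleftrightarrow> (\<forall>a. \<exists>n>0. (\<sigma> ^^ n) a = a)"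

definition skew_derivation :: "('a::ring \<Rightarrow> 'a) \<Rightarrow> ('a \<Rightarrow> 'a) \<Rightarrow> bool" where
  "skew_derivation \<sigma> D \<longleftrightarrow>
     (\<forall>a b. D (a + b) = D a + D b) \<and> (\<forall>a b. D (a * b) = \<sigma> a * D b + D a * b)"


section \<open>Ore extensions\<close>

text \<open>
  Elements of the Ore extension are polynomials \<open>\<Sum>i. a\<^sub>i x\<^sup>i\<close> with coefficients on the left.
  Left multiplication by \<open>x\<close> (which itself need not be in the ring) sends \<open>b x\<^sup>j\<close> to
  \<open>\<sigma>(b) x\<^sup>j\<^sup>+\<^sup>1 + D(b) x\<^sup>j\<close>, and \<open>a\<^sub>i x\<^sup>i\<close> acts on the left by \<open>i\<close> such steps followed by
  multiplying all coefficients by \<open>a\<^sub>i\<close>.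
\<close>

definition ore_x :: "('a::ring \<Rightarrow> 'a) \<Rightarrow> ('a \<Rightarrow> 'a) \<Rightarrow> 'a poly \<Rightarrow> 'a poly" where
  "ore_x \<sigma> D q = pCons 0 (map_poly \<sigma> q) + map_poly D q"

definition ore_mult :: "('a::ring \<Rightarrow> 'a) \<Rightarrow> ('a \<Rightarrow> 'a) \<Rightarrow> 'a poly \<Rightarrow> 'a poly \<Rightarrow> 'a poly" where
  "ore_mult \<sigma> D p q = (\<Sum>i\<le>degree p. map_poly ((*) (coeff p i)) ((ore_x \<sigma> D ^^ i) q))"

text \<open>The lemmas below confirm that this is the multiplication of a ring extending the base ring.\<close>

context
  fixes \<sigma> D :: "'a::ring \<Rightarrow> 'a"
  assumes aut: "ring_automorphism \<sigma>" and der: "skew_derivation \<sigma> D"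
begin

lemma ore_maps:
  "\<sigma> (a + b) = \<sigma> a + \<sigma> b" "\<sigma> (a * b) = \<sigma> a * \<sigma> b"
  "D (a + b) = D a + D b" "D (a * b) = \<sigma> a * D b + D a * b"
  using aut der by (auto simp: ring_automorphism_def skew_derivation_def)

lemma ore_maps_0: "\<sigma> 0 = 0" "D 0 = 0"
  using ore_maps(1)[of 0 0] ore_maps(3)[of 0 0] by auto

lemma coeff_ore_x:
  "coeff (ore_x \<sigma> D q) n = (case n of 0 \<Rightarrow> 0 | Suc k \<Rightarrow> \<sigma> (coeff q k)) + D (coeff q n)"
  by (auto simp: ore_x_def coeff_map_poly ore_maps_0 coeff_pCons split: nat.split)

lemma ore_x_add: "ore_x \<sigma> D (p + q) = ore_x \<sigma> D p + ore_x \<sigma> D q"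
  by (rule poly_eqI) (auto simp: coeff_ore_x ore_maps algebra_simps split: nat.split)

lemma ore_x_0: "ore_x \<sigma> D 0 = 0"
  by (rule poly_eqI) (auto simp: coeff_ore_x ore_maps_0 split: nat.split)

lemma ore_x_pow_add: "(ore_x \<sigma> D ^^ n) (p + q) = (ore_x \<sigma> D ^^ n) p + (ore_x \<sigma> D ^^ n) q"
  by (induction n) (auto simp: ore_x_add)

lemma ore_x_sum: "ore_x \<sigma> D (sum g A) = (\<Sum>i\<in>A. ore_x \<sigma> D (g i))"
  by (induction A rule: infinite_finite_induct) (auto simp: ore_x_add ore_x_0)

lemma coeff_lmult: "coeff (map_poly ((*) (a::'a)) q) n = a * coeff q n"
  by (simp add: coeff_map_poly)

lemma lmult_add: "map_poly ((*) (a::'a)) (p + q) = map_poly ((*) a) p + map_poly ((*) a) q"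
  by (rule poly_eqI) (simp add: coeff_lmult algebra_simps)

lemma lmult_add_left: "map_poly ((*) (a + b::'a)) p = map_poly ((*) a) p + map_poly ((*) b) p"
  by (rule poly_eqI) (simp add: coeff_lmult algebra_simps)

lemma lmult_0: "map_poly ((*) (0::'a)) p = 0"
  by (rule poly_eqI) (simp add: coeff_lmult)

lemma lmult_sum: "map_poly ((*) (a::'a)) (sum g A) = (\<Sum>i\<in>A. map_poly ((*) a) (g i))"
  by (induction A rule: infinite_finite_induct) (auto simp: lmult_add)

lemma lmult_lmult: "map_poly ((*) (a::'a)) (map_poly ((*) b) p) = map_poly ((*) (a * b)) p"
  by (rule poly_eqI) (simp add: coeff_lmult mult.assoc)

lemma ore_x_lmult:
  "ore_x \<sigma> D (map_poly ((*) a) q) =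
     map_poly ((*) (\<sigma> a)) (ore_x \<sigma> D q) + map_poly ((*) (D a)) q"
  by (rule poly_eqI) (auto simp: coeff_ore_x coeff_lmult ore_maps algebra_simps split: nat.split)

lemma ore_mult_altdef:
  assumes "degree p \<le> N"
  shows "ore_mult \<sigma> D p q = (\<Sum>i\<le>N. map_poly ((*) (coeff p i)) ((ore_x \<sigma> D ^^ i) q))"
  unfolding ore_mult_def
  by (rule sum.mono_neutral_left) (use assms in \<open>auto simp: coeff_eq_0 lmult_0\<close>)

lemma ore_mult_distrib_left:
  "ore_mult \<sigma> D p (q + r) = ore_mult \<sigma> D p q + ore_mult \<sigma> D p r"
  by (simp add: ore_mult_def ore_x_pow_add lmult_add sum.distrib)

lemma ore_mult_distrib_right:
  "ore_mult \<sigma> D (p + q) r = ore_mult \<sigma> D p r + ore_mult \<sigma> D q r"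
proof -
  define N where "N = max (degree p) (degree q)"
  have "degree (p + q) \<le> N" "degree p \<le> N" "degree q \<le> N"
    by (auto simp: N_def degree_add_le_max)
  then show ?thesis
    by (simp add: ore_mult_altdef lmult_add_left sum.distrib)
qed

lemma ore_mult_0_left: "ore_mult \<sigma> D 0 q = 0"
  by (simp add: ore_mult_def lmult_0)

lemma ore_mult_sum_left: "ore_mult \<sigma> D (sum g A) q = (\<Sum>i\<in>A. ore_mult \<sigma> D (g i) q)"
  by (induction A rule: infinite_finite_induct) (auto simp: ore_mult_distrib_right ore_mult_0_left)

lemma ore_mult_lmult:
  "ore_mult \<sigma> D (map_poly ((*) a) q) r = map_poly ((*) a) (ore_mult \<sigma> D q r)"
proof -
  have "degree (map_poly ((*) a) q) \<le> degree q"
    by (simp add: map_poly_degree_leq)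
  then show ?thesis
    by (simp add: ore_mult_altdef[of _ "degree q"] lmult_sum lmult_lmult coeff_lmult)
qed

lemma ore_mult_ore_x: "ore_mult \<sigma> D (ore_x \<sigma> D q) r = ore_x \<sigma> D (ore_mult \<sigma> D q r)"
proof -
  define N where "N = degree q"
  define X where "X = ore_x \<sigma> D"
  have d: "degree (X q) \<le> Suc N"
    by (rule degree_le) (auto simp: X_def N_def coeff_ore_x coeff_eq_0 ore_maps_0 split: nat.split)
  have e: "coeff q (Suc N) = 0"
    by (simp add: N_def coeff_eq_0)
  have "ore_mult \<sigma> D (X q) r =
      (\<Sum>i\<le>Suc N. map_poly ((*) (case i of 0 \<Rightarrow> 0 | Suc k \<Rightarrow> \<sigma> (coeff q k))) ((X ^^ i) r)) +
      (\<Sum>i\<le>Suc N. map_poly ((*) (D (coeff q i))) ((X ^^ i) r))"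
    using d by (simp add: ore_mult_altdef X_def coeff_ore_x lmult_add_left sum.distrib
        del: sum.atMost_Suc)
  also have "(\<Sum>i\<le>Suc N. map_poly ((*) (case i of 0 \<Rightarrow> 0 | Suc k \<Rightarrow> \<sigma> (coeff q k))) ((X ^^ i) r)) =
      (\<Sum>i\<le>N. map_poly ((*) (\<sigma> (coeff q i))) (X ((X ^^ i) r)))"
    by (subst sum.atMost_Suc_shift) (simp add: lmult_0)
  also have "(\<Sum>i\<le>Suc N. map_poly ((*) (D (coeff q i))) ((X ^^ i) r)) =
      (\<Sum>i\<le>N. map_poly ((*) (D (coeff q i))) ((X ^^ i) r))"
    by (simp add: e ore_maps_0 lmult_0)
  also have "(\<Sum>i\<le>N. map_poly ((*) (\<sigma> (coeff q i))) (X ((X ^^ i) r))) +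
      (\<Sum>i\<le>N. map_poly ((*) (D (coeff q i))) ((X ^^ i) r)) = X (ore_mult \<sigma> D q r)"
    by (simp add: ore_mult_def X_def N_def ore_x_sum ore_x_lmult sum.distrib)
  finally show ?thesis
    by (simp add: X_def)
qed

lemma ore_mult_assoc:
  "ore_mult \<sigma> D (ore_mult \<sigma> D p q) r = ore_mult \<sigma> D p (ore_mult \<sigma> D q r)"
proof -
  have "ore_mult \<sigma> D ((ore_x \<sigma> D ^^ i) q) r = (ore_x \<sigma> D ^^ i) (ore_mult \<sigma> D q r)" for i
    by (induction i) (auto simp: ore_mult_ore_x)
  then show ?thesis
    by (simp add: ore_mult_def[of \<sigma> D p] ore_mult_sum_left ore_mult_lmult)
qed

lemma ore_mult_const: "ore_mult \<sigma> D [:a:] [:b:] = [:a * b:]"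
  by (rule poly_eqI) (simp add: ore_mult_def coeff_lmult coeff_pCons split: nat.split)

lemma ore_mult_monom: "ore_mult \<sigma> D (monom a m) (monom b n) =
    map_poly ((*) a) ((ore_x \<sigma> D ^^ m) (monom b n))"
proof -
  have "ore_mult \<sigma> D (monom a m) (monom b n) =
      (\<Sum>i\<le>m. map_poly ((*) (coeff (monom a m) i)) ((ore_x \<sigma> D ^^ i) (monom b n)))"
    by (rule ore_mult_altdef) (simp add: degree_monom_le)
  also have "\<dots> = (\<Sum>i\<le>m. if i = m then map_poly ((*) a) ((ore_x \<sigma> D ^^ m) (monom b n)) else 0)"
    by (rule sum.cong) (auto simp: lmult_0)
  finally show ?thesis
    by simp
qed

lemma ore_x_monom: "ore_x \<sigma> D (monom b n) = monom (\<sigma> b) (Suc n) + monom (D b) n"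
  by (rule poly_eqI) (auto simp: coeff_ore_x ore_maps_0 split: nat.split)

end

end

theory Submission
  imports Defs "HOL-Library.Sublist" "HOL-Combinatorics.Multiset_Permutations"
begin

text \<open>
  Suppose that \<open>I = J(R[x;\<sigma>,D]) \<inter> R\<close> contains an element that is not nilpotent, and choose a prime
  ideal \<open>P\<close> of \<open>R\<close> that avoids its powers. Neither \<open>\<sigma>\<close> nor \<open>D\<close> need preserve \<open>P\<close>. Still, the
  left module \<open>R[x;\<sigma>,D] / R[x;\<sigma>,D] P\<close> is filtered by degree, and an element \<open>f\<close> of degree \<open>m > 0\<close>
  whose leading coefficient \<open>w\<close> has all its \<open>\<sigma>\<close>-translates left regular modulo \<open>P\<close> raises degrees
  by exactly \<open>m\<close>. So \<open>1 - f\<close> is not surjective on this module, and \<open>f\<close> is not in the radical.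

  To find such an \<open>f\<close> in the radical, one needs an element \<open>z\<close> of \<open>I - P\<close> that is central modulo
  every \<open>\<sigma>\<close>-translate of \<open>P\<close> not containing it; then \<open>w\<close> is an elementary symmetric function of
  the finite orbit of \<open>z\<close>. Such a \<open>z\<close> is the value of a central polynomial. Since \<open>R\<close> satisfies a
  polynomial identity, comparing the number \<open>n!\<close> of words \<open>y\<^sub>0 x\<^bsub>\<pi> 1\<^esub> y\<^sub>1 x\<^bsub>\<pi> 2\<^esub> y\<^sub>2 \<dots>\<close> with the
  exponential number of words without long decreasing subsequences gives an identity among
  these words, hence a Capelli identity modulo \<open>P\<close>. If \<open>t\<close> is minimal such that
  the Capelli polynomial in \<open>t + 1\<close> variables vanishes modulo \<open>P\<close>, the resulting form of Cramer's
  rule yields multiples of coordinate functionals and of a trace form on \<open>R / P\<close>, and the Casimir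
  element of that form is central.
\<close>

section \<open>Integer multiples\<close>

lemma int_scale_0 [simp]: "int_scale 0 a = 0"
  by (simp add: int_scale_def)

lemma int_scale_Suc: "int_scale (k + 1) a = int_scale k a + a"
proof (cases "k \<ge> 0")
  case True
  then have "nat (k + 1) = Suc (nat k)" by simp
  with True show ?thesis by (simp add: int_scale_def add.commute)
next
  case False
  then have "nat (- k) = Suc (nat (- (k + 1)))" by simp
  then have "int_scale k a = - (a + ((+) a ^^ nat (- (k + 1))) 0)"
    using False by (simp add: int_scale_def del: minus_add_distrib)
  moreover have "int_scale (k + 1) a = - (((+) a ^^ nat (- (k + 1))) 0)"
    using False by (cases "k = - 1") (auto simp: int_scale_def)
  ultimately show ?thesis by simp
qed

lemma int_scale_add: "int_scale (k + l) a = int_scale k a + int_scale l a"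
proof (induction l rule: int_induct[of _ 0])
  case (step1 l)
  have "int_scale (k + (l + 1)) a = int_scale (k + l) a + a"
    using int_scale_Suc[of "k + l" a] by (simp add: add.assoc)
  then show ?case using step1 by (simp add: int_scale_Suc)
next
  case (step2 l)
  have "int_scale (k + l) a = int_scale (k + (l - 1)) a + a"
    using int_scale_Suc[of "k + (l - 1)" a] by (simp add: algebra_simps)
  moreover have "int_scale l a = int_scale (l - 1) a + a"
    using int_scale_Suc[of "l - 1" a] by simp
  ultimately show ?case using step2 by (simp add: algebra_simps)
qed simp

lemma int_scale_1 [simp]: "int_scale 1 a = a"
  using int_scale_Suc[of 0 a] by simp

lemma int_scale_uminus: "int_scale (- k) a = - int_scale k a"
  using int_scale_add[of k "- k" a] by (simp add: eq_neg_iff_add_eq_0 add.commute)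

lemma int_scale_diff: "int_scale (k - l) a = int_scale k a - int_scale l a"
  using int_scale_add[of k "- l" a] by (simp add: int_scale_uminus)

lemma int_scale_of_additive:
  assumes "\<And>a b. f (a + b) = f a + f b"
  shows "f (int_scale k a) = int_scale k (f a)"
proof -
  have f0: "f 0 = 0" using assms[of 0 0] by simp
  have f_uminus: "f (- a) = - f a" for a
    using assms[of a "- a"] f0 by (simp add: eq_neg_iff_add_eq_0 add.commute)
  have "f (((+) a ^^ n) 0) = ((+) (f a) ^^ n) 0" for n
    by (induction n) (simp_all add: f0 assms)
  then show ?thesis by (simp add: int_scale_def f_uminus)
qed

lemma int_scale_mult: "int_scale (k * l) a = int_scale k (int_scale l a)"
proof (induction k rule: int_induct[of _ 0])
  case (step1 k)
  then show ?case by (simp add: distrib_right int_scale_add)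
next
  case (step2 k)
  then show ?case by (simp add: left_diff_distrib int_scale_diff)
qed simp

lemma int_scale_zero_right [simp]: "int_scale k (0::'a::ab_group_add) = 0"
  using int_scale_mult[of k 0 "0::'a"] by simp

lemma int_scale_sum_left: "int_scale (sum f A) a = (\<Sum>i\<in>A. int_scale (f i) a)"
  by (induction A rule: infinite_finite_induct) (auto simp: int_scale_add)

lemma int_scale_add_right: "int_scale k (a + b) = int_scale k a + int_scale k b"
proof (induction k rule: int_induct[of _ 0])
  case (step1 k)
  then show ?case by (simp add: int_scale_add algebra_simps)
next
  case (step2 k)
  then show ?case by (simp add: int_scale_diff algebra_simps)
qed simp

lemma int_scale_sum_right: "int_scale k (sum f A) = (\<Sum>i\<in>A. int_scale k (f i))"
  by (induction A rule: infinite_finite_induct) (auto simp: int_scale_add_right)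

lemma int_scale_mult_left: "int_scale k a * b = int_scale k (a * b :: 'a::ring)"
  by (rule int_scale_of_additive) (rule distrib_right)

lemma int_scale_mult_right: "a * int_scale k b = int_scale k (a * b :: 'a::ring)"
  by (rule int_scale_of_additive) (rule distrib_left)

section \<open>Prime ideals\<close>

text \<open>Primeness is tested on the sandwiches \<open>a * r * b\<close>; also without an identity
  this is equivalent to primeness for products of ideals.\<close>

locale prime_ideal =
  fixes P :: "'a::ring set"
  assumes two_sided: "two_sided_ideal (*) P"
    and proper: "P \<noteq> UNIV"
    and prime: "(\<And>r. a * r * b \<in> P) \<Longrightarrow> a \<in> P \<or> b \<in> P"
begin

lemma left_ideal: "left_ideal (*) P"
  using two_sided by (simp add: two_sided_ideal_def)

lemma zero [simp]: "0 \<in> P"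
  using left_ideal by (simp add: left_ideal_def)

lemma diff: "a \<in> P \<Longrightarrow> b \<in> P \<Longrightarrow> a - b \<in> P"
  using left_ideal by (simp add: left_ideal_def)

lemma uminus: "a \<in> P \<Longrightarrow> - a \<in> P"
  using diff[of 0 a] by simp

lemma add: "a \<in> P \<Longrightarrow> b \<in> P \<Longrightarrow> a + b \<in> P"
  using diff[of a "- b"] uminus[of b] by simp

lemma multl: "b \<in> P \<Longrightarrow> a * b \<in> P"
  using left_ideal by (simp add: left_ideal_def)

lemma multr: "a \<in> P \<Longrightarrow> a * b \<in> P"
  using two_sided by (simp add: two_sided_ideal_def)

lemma sum: "(\<And>i. i \<in> A \<Longrightarrow> g i \<in> P) \<Longrightarrow> sum g A \<in> P"
  by (induction A rule: infinite_finite_induct) (auto intro: add)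

lemma diff_iff: "a - b \<in> P \<Longrightarrow> a \<in> P \<longleftrightarrow> b \<in> P"
  using diff[of a "a - b"] add[of "a - b" b] by auto

lemma diff_trans: "a - b \<in> P \<Longrightarrow> b - c \<in> P \<Longrightarrow> a - c \<in> P"
  using add[of "a - b" "b - c"] by simp

lemma diff_sym: "a - b \<in> P \<Longrightarrow> b - a \<in> P"
  using uminus[of "a - b"] by simp

lemma sum_diff: "(\<And>i. i \<in> A \<Longrightarrow> g i - h i \<in> P) \<Longrightarrow> sum g A - sum h A \<in> P"
  using sum[of A "\<lambda>i. g i - h i"] by (simp add: sum_subtractf)

lemma prime': "a \<notin> P \<Longrightarrow> (\<And>r. a * r * b \<in> P) \<Longrightarrow> b \<in> P"
  using prime by blast

lemma prime_right: "b \<notin> P \<Longrightarrow> (\<And>r. a * r * b \<in> P) \<Longrightarrow> a \<in> P"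
  using prime by blast

lemma prime3: "a \<notin> P \<Longrightarrow> c \<notin> P \<Longrightarrow> (\<And>r s. a * r * b * s * c \<in> P) \<Longrightarrow> b \<in> P"
  using prime'[of a b] prime_right[of c] by blast

text \<open>No identity can be put for \<open>r\<close>. Instead a factor \<open>b\<close> outside
  \<open>P\<close> is appended, and primeness applies to \<open>a * r * b\<close>.\<close>

lemma mult_cancel: "(\<And>r. a * r \<in> P) \<Longrightarrow> a \<in> P"
proof -
  assume *: "\<And>r. a * r \<in> P"
  obtain b where "b \<notin> P" using proper by blast
  then show "a \<in> P"
    by (rule prime_right) (rule *[of "_ * b", folded mult.assoc])
qed

text \<open>
  The relation \<open>\<Sum>i. a i \<otimes> b i = 0\<close> over the extended centroid is symmetric in the two factors.
\<close>

lemma flip: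
  assumes "finite A" "\<And>q. (\<Sum>i\<in>A. a i * q * b i) \<in> P"
  shows "(\<Sum>i\<in>A. b i * r * a i) \<in> P"
  using assms
proof (induction "card A" arbitrary: A b r rule: less_induct)
  case less
  define F where "F r = (\<Sum>i\<in>A. b i * r * a i)" for r
  \<comment> \<open>The element \<open>b' j\<close> is zero, so \<open>b'\<close> satisfies a
    relation with one index fewer. Its flipped form moves \<open>b j * s\<close> inside
    \<open>F\<close>.\<close>
  have shift: "b j * s * F r - F (s * b j * r) \<in> P" if j: "j \<in> A" for j s r
  proof -
    define b' where "b' i = b j * s * b i - b i * s * b j" for i
    have eq: "(\<Sum>i\<in>A - {j}. a i * q * b' i) = (\<Sum>i\<in>A. a i * (q * b j * s) * b i) -
        (\<Sum>i\<in>A. a i * q * b i) * (s * b j)" for q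
    proof -
      have "(\<Sum>i\<in>A - {j}. a i * q * b' i) = (\<Sum>i\<in>A. a i * q * b' i)"
        using j less.prems(1) by (simp add: sum.remove[of A j] b'_def)
      then show ?thesis
        by (simp add: b'_def sum_distrib_right sum_subtractf[symmetric] right_diff_distrib mult.assoc)
    qed
    have "(\<Sum>i\<in>A - {j}. b' i * r * a i) \<in> P"
    proof (rule less.hyps)
      show "card (A - {j}) < card A"
        using less.prems(1) j by (rule card_Diff1_less)
      show "finite (A - {j})"
        using less.prems(1) by simp
      show "(\<Sum>i\<in>A - {j}. a i * q * b' i) \<in> P" for q
        unfolding eq using diff[OF less.prems(2) multr[OF less.prems(2)]] .
    qed
    moreover have "(\<Sum>i\<in>A - {j}. b' i * r * a i) = (\<Sum>i\<in>A. b' i * r * a i)"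
      using j less.prems(1) by (simp add: sum.remove[of A j] b'_def)
    moreover have "\<dots> = b j * s * F r - F (s * b j * r)"
      by (simp add: b'_def F_def sum_distrib_left sum_subtractf[symmetric] left_diff_distrib mult.assoc)
    ultimately show ?thesis by simp
  qed
  show ?case
  proof (rule ccontr)
    assume "\<not> ?case"
    then have F: "F r \<notin> P" by (simp add: F_def)
    \<comment> \<open>Modulo \<open>P\<close>, both \<open>b j * s * b k * t * F r\<close> and
      \<open>b k * s * b j * t * F r\<close> equal \<open>F (s * b j * t * b k * r)\<close>.\<close>
    have comm: "b j * s * b k - b k * s * b j \<in> P" if "j \<in> A" "k \<in> A" for j k s
    proof (rule prime_right[OF F])
      fix t
      have "b j * s * (b k * t * F r - F (t * b k * r)) \<in> P"
        by (intro multl shift that)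
      moreover have "b j * s * F (t * b k * r) - F (s * b j * (t * b k * r)) \<in> P"
        by (intro shift that)
      moreover have "b k * (s * b j * t) * F r - F ((s * b j * t) * b k * r) \<in> P"
        by (intro shift that)
      ultimately have in_P: "b j * s * (b k * t * F r - F (t * b k * r)) +
          (b j * s * F (t * b k * r) - F (s * b j * (t * b k * r))) -
          (b k * (s * b j * t) * F r - F ((s * b j * t) * b k * r)) \<in> P"
        by (rule diff[OF add])
      have "b j * s * (b k * t * F r - F (t * b k * r)) +
          (b j * s * F (t * b k * r) - F (s * b j * (t * b k * r))) -
          (b k * (s * b j * t) * F r - F ((s * b j * t) * b k * r)) =
          (b j * s * b k - b k * s * b j) * t * F r"
        by (simp add: left_diff_distrib right_diff_distrib mult.assoc)
      with in_P show "(b j * s * b k - b k * s * b j) * t * F r \<in> P" by simp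
    qed
    have "b j * r * a j \<in> P" if j: "j \<in> A" for j
    proof -
      have "a j \<in> P \<or> b j \<in> P"
      proof (rule ccontr)
        assume neither: "\<not> ?thesis"
        have "F r \<in> P"
        proof (rule prime3)
          show "a j \<notin> P" "b j \<notin> P" using neither by auto
          fix p s
          \<comment> \<open>Exchanging \<open>b i\<close> and \<open>b j\<close> turns the sum for
            \<open>a j * p * F r * s * b j\<close> into a multiple of the given relation.\<close>
          have swap: "(\<Sum>i\<in>A. a j * p * (b i * (r * a i * s) * b j)) -
              (\<Sum>i\<in>A. a j * p * (b j * (r * a i * s) * b i)) \<in> P"
            by (intro sum_diff) (simp only: right_diff_distrib[symmetric] multl comm[OF _ j])
          have "(\<Sum>i\<in>A. a j * p * (b j * (r * a i * s) * b i)) =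
              a j * p * b j * r * (\<Sum>i\<in>A. a i * s * b i)"
            by (simp add: sum_distrib_left mult.assoc)
          also have "\<dots> \<in> P"
            using less.prems(2) by (intro multl)
          finally have "(\<Sum>i\<in>A. a j * p * (b i * (r * a i * s) * b j)) \<in> P"
            using diff_iff[OF swap] by simp
          also have "(\<Sum>i\<in>A. a j * p * (b i * (r * a i * s) * b j)) = a j * p * F r * s * b j"
            by (simp add: F_def sum_distrib_left sum_distrib_right mult.assoc)
          finally show "a j * p * F r * s * b j \<in> P" .
        qed
        with F show False by blast
      qed
      then show ?thesis by (auto intro: multl multr)
    qed
    then have "F r \<in> P"
      unfolding F_def by (rule sum)
    with F show False by blast
  qed
qed

end

section \<open>Elementary operators\<close>

text \<open>Both outer factors are always present because there is no identity; in
  \<open>cap\<close> the entries of \<open>y\<close> supply them.\<close>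

definition elem_op :: "('a::ring \<Rightarrow> 'a) \<Rightarrow> bool" where
  "elem_op g \<longleftrightarrow> (\<exists>L. \<forall>r. g r = (\<Sum>(a, b)\<leftarrow>L. a * r * b))"

lemma elem_op_single: "elem_op (\<lambda>r. c * r * d)"
  unfolding elem_op_def by (intro exI[of _ "[(c, d)]"]) simp

lemma elem_op_zero: "elem_op (\<lambda>r. 0)"
  unfolding elem_op_def by (intro exI[of _ "[]"]) simp

lemma elem_op_add: "elem_op g \<Longrightarrow> elem_op h \<Longrightarrow> elem_op (\<lambda>r. g r + h r)"
  unfolding elem_op_def
proof (elim exE)
  fix L K assume "\<forall>r. g r = (\<Sum>(a, b)\<leftarrow>L. a * r * b)" "\<forall>r. h r = (\<Sum>(a, b)\<leftarrow>K. a * r * b)"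
  then show "\<exists>L. \<forall>r. g r + h r = (\<Sum>(a, b)\<leftarrow>L. a * r * b)"
    by (intro exI[of _ "L @ K"]) simp
qed

lemma elem_op_uminus: "elem_op g \<Longrightarrow> elem_op (\<lambda>r. - g r)"
  unfolding elem_op_def
proof (elim exE)
  fix L assume L: "\<forall>r. g r = (\<Sum>(a, b)\<leftarrow>L. a * r * b)"
  have "- (\<Sum>(a, b)\<leftarrow>L. a * r * b) = (\<Sum>(a, b)\<leftarrow>map (\<lambda>(a, b). (- a, b)) L. a * r * b)" for r
    by (induction L) auto
  with L show "\<exists>L. \<forall>r. - g r = (\<Sum>(a, b)\<leftarrow>L. a * r * b)"
    by metis
qed

lemma elem_op_diff: "elem_op g \<Longrightarrow> elem_op h \<Longrightarrow> elem_op (\<lambda>r. g r - h r)"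
  using elem_op_add[of g "\<lambda>r. - h r"] elem_op_uminus[of h] by simp

lemma elem_op_sandwich:
  assumes "elem_op g"
  shows "elem_op (\<lambda>r. g (c * r * d))" "elem_op (\<lambda>r. g (c * r))" "elem_op (\<lambda>r. g r * d)"
proof -
  obtain L where L: "\<And>r. g r = (\<Sum>(a, b)\<leftarrow>L. a * r * b)"
    using assms by (auto simp: elem_op_def)
  have "g (c * r * d) = (\<Sum>(a, b)\<leftarrow>map (\<lambda>(a, b). (a * c, d * b)) L. a * r * b)" for r
    unfolding L by (induction L) (auto simp: mult.assoc)
  then show "elem_op (\<lambda>r. g (c * r * d))" unfolding elem_op_def by metis
  have "g (c * r) = (\<Sum>(a, b)\<leftarrow>map (\<lambda>(a, b). (a * c, b)) L. a * r * b)" for r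
    unfolding L by (induction L) (auto simp: mult.assoc)
  then show "elem_op (\<lambda>r. g (c * r))" unfolding elem_op_def by metis
  have "g r * d = (\<Sum>(a, b)\<leftarrow>map (\<lambda>(a, b). (a, b * d)) L. a * r * b)" for r
    unfolding L by (induction L) (auto simp: mult.assoc distrib_right)
  then show "elem_op (\<lambda>r. g r * d)" unfolding elem_op_def by metis
qed

lemma elem_op_sum:
  "(\<And>i. i \<in> A \<Longrightarrow> elem_op (g i)) \<Longrightarrow> elem_op (\<lambda>r. \<Sum>i\<in>A. g i r)"
  by (induction A rule: infinite_finite_induct) (auto intro: elem_op_add elem_op_zero)

lemma elem_op_eq_sum:
  assumes "elem_op g"
  shows "\<exists>(m::nat) \<alpha> \<beta>. \<forall>r. g r = (\<Sum>l<m. \<alpha> l * r * \<beta> l)"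
proof -
  obtain L where L: "\<And>r. g r = (\<Sum>(a, b)\<leftarrow>L. a * r * b)"
    using assms by (auto simp: elem_op_def)
  have "g r = (\<Sum>l<length L. fst (L ! l) * r * snd (L ! l))" for r
    unfolding L sum_list_sum_nth by (simp add: lessThan_atLeast0 split_beta)
  then show ?thesis by (intro exI allI)
qed

lemma elem_op_plus: "elem_op g \<Longrightarrow> g (a + b) = g a + g b"
  by (drule elem_op_eq_sum) (auto simp: distrib_left distrib_right sum.distrib)

lemma elem_op_0: "elem_op g \<Longrightarrow> g 0 = 0"
  using elem_op_plus[of g 0 0] by simp

lemma elem_op_of_sum: "elem_op g \<Longrightarrow> g (sum f A) = (\<Sum>i\<in>A. g (f i))"
  by (induction A rule: infinite_finite_induct) (auto simp: elem_op_plus elem_op_0)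

section \<open>Capelli polynomials\<close>

text \<open>
  \<open>cap n x y\<close> is the Capelli polynomial
  \<open>\<Sum>\<pi>. sgn \<pi> \<cdot> y\<^sub>0 x\<^bsub>\<pi> 0\<^esub> y\<^sub>1 x\<^bsub>\<pi> 1\<^esub> y\<^sub>2 \<dots> x\<^bsub>\<pi> (n - 1)\<^esub> y\<^sub>n\<close>, expanded along its last entry.
\<close>

fun cap :: "nat \<Rightarrow> (nat \<Rightarrow> 'a::ring) \<Rightarrow> (nat \<Rightarrow> 'a) \<Rightarrow> 'a" where
  "cap 0 x y = y 0"
| "cap (Suc n) x y = cap n x y * x n * y (Suc n) -
     (\<Sum>i<n. cap n (x(i := x n)) y * x i * y (Suc n))"

lemma cap_cong: "(\<And>i. i < n \<Longrightarrow> x i = x' i) \<Longrightarrow> (\<And>i. i \<le> n \<Longrightarrow> y i = y' i) \<Longrightarrow>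
  cap n x y = cap n x' y'"
proof (induction n arbitrary: x x')
  case (Suc n)
  have "cap n x y = cap n x' y'"
    using Suc.prems by (intro Suc.IH) auto
  moreover have "cap n (x(i := x n)) y = cap n (x'(i := x' n)) y'" for i
    using Suc.prems by (intro Suc.IH) auto
  ultimately show ?case using Suc.prems by simp
qed simp

lemma cap_last: "cap n x (y(n := y n * q)) = cap n x y * q"
proof (cases n)
  case (Suc k)
  have "cap k x (y(Suc k := z)) = cap k x y" for z x
    by (rule cap_cong) auto
  then show ?thesis
    by (simp add: Suc sum_distrib_right left_diff_distrib mult.assoc)
qed simp


lemma elem_op_cap: "i < n \<Longrightarrow> elem_op (\<lambda>r. cap n (x(i := r)) y)"
proof (induction n arbitrary: x i)
  case (Suc n)
  show ?case
  proof (cases "i = n")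
    case True
    have 1: "cap n (x(n := z)) y = cap n x y" for z
      by (rule cap_cong) auto
    have 2: "cap n (x(n := z, j := z)) y = cap n (x(j := z)) y" for z j
      by (rule cap_cong) auto
    have "elem_op (\<lambda>r. cap n x y * r * y (Suc n) -
        (\<Sum>j<n. cap n (x(j := r)) y * (x j * y (Suc n))))"
      by (intro elem_op_diff elem_op_sum elem_op_single elem_op_sandwich(3) Suc.IH) auto
    moreover have eq: "cap (Suc n) (x(n := r)) y = cap n x y * r * y (Suc n) -
        (\<Sum>j<n. cap n (x(j := r)) y * (x j * y (Suc n)))" for r
      by (rule trans[OF cap.simps(2)]) (simp add: 1 2 mult.assoc)
    ultimately show ?thesis unfolding True eq by simp
  next
    case False
    with Suc.prems have i: "i < n" by simp
    have S: "elem_op (\<lambda>r. cap n (x(i := r, j := x n)) y * (x(i := r)) j * y (Suc n))"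
      if "j < n" for j
    proof (cases "j = i")
      case True
      then show ?thesis using elem_op_single by simp
    next
      case False
      have "elem_op (\<lambda>r. cap n ((x(j := x n))(i := r)) y * (x j * y (Suc n)))"
        by (intro elem_op_sandwich(3) Suc.IH i)
      with False show ?thesis by (simp add: fun_upd_twist mult.assoc)
    qed
    have "elem_op (\<lambda>r. cap n (x(i := r)) y * (x n * y (Suc n)) -
        (\<Sum>j<n. cap n (x(i := r, j := x n)) y * (x(i := r)) j * y (Suc n)))"
      by (rule elem_op_diff[OF elem_op_sandwich(3)[OF Suc.IH[OF i]] elem_op_sum]) (rule S, simp)
    moreover have eq: "cap (Suc n) (x(i := r)) y = cap n (x(i := r)) y * (x n * y (Suc n)) -
        (\<Sum>j<n. cap n (x(i := r, j := x n)) y * (x(i := r)) j * y (Suc n))" for r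
      by (rule trans[OF cap.simps(2)]) (use False in \<open>simp add: mult.assoc\<close>)
    ultimately show ?thesis unfolding eq by simp
  qed
qed simp

text \<open>If the last entry is involved, the first term of the expansion cancels against the
  summand at the equal index, and the other summands have a repeated entry. Otherwise the summands
  at \<open>i\<close> and \<open>j\<close> cancel by antisymmetry, which follows from biadditivity
  and vanishing on the diagonal.\<close>

lemma cap_alternating:
  "i < n \<Longrightarrow> j < n \<Longrightarrow> i \<noteq> j \<Longrightarrow> x i = x j \<Longrightarrow> cap n x y = 0"
proof (induction n arbitrary: x i j)
  case (Suc n)
  have last: "cap (Suc n) x y = 0" if i: "i < n" and eq: "x i = x n" for i
  proof -
    have "(\<Sum>k\<in>{..<n} - {i}. cap n (x(k := x n)) y * x k * y (Suc n)) = 0"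
    proof (intro sum.neutral ballI)
      fix k assume "k \<in> {..<n} - {i}"
      then have "cap n (x(k := x n)) y = 0"
        using i eq by (intro Suc.IH[of k i]) auto
      then show "cap n (x(k := x n)) y * x k * y (Suc n) = 0" by simp
    qed
    moreover have "x(i := x n) = x" using eq by auto
    ultimately show ?thesis
      using i eq by (simp add: sum.remove[of "{..<n}" i])
  qed
  show ?case
  proof (cases "i = n \<or> j = n")
    case True
    then show ?thesis using last[of i] last[of j] Suc.prems by auto
  next
    case False
    with Suc.prems have ij: "i < n" "j < n" by auto
    define c where "c z w = cap n (x(i := z, j := w)) y" for z w
    have diag: "c z z = 0" for z
      unfolding c_def using ij Suc.prems by (intro Suc.IH[of i j]) auto
    have add1: "c (z + z') w = c z w + c z' w" for z z' w
      using elem_op_plus[OF elem_op_cap[OF ij(1)], of "x(j := w)"] Suc.prems(3)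
      by (simp add: c_def fun_upd_twist)
    have add2: "c z (w + w') = c z w + c z w'" for z w w'
      using elem_op_plus[OF elem_op_cap[OF ij(2)], of "x(i := z)"] by (simp add: c_def)
    have anti: "c z w + c w z = 0" for z w
    proof -
      have "c (z + w) (z + w) = c z w + c w z"
        by (simp add: add1 add2 diag[of z] diag[of w])
      then show ?thesis by (simp add: diag)
    qed
    have upd: "x(i := x n) = x(i := x n, j := x i)" "x(j := x n) = x(i := x i, j := x n)"
      using Suc.prems by auto
    have ci: "cap n (x(i := x n)) y = c (x n) (x i)" "cap n (x(j := x n)) y = c (x i) (x n)"
      unfolding c_def using upd[THEN arg_cong, of "\<lambda>z. cap n z y"] .
    define g where "g k = cap n (x(k := x n)) y * x k * y (Suc n)" for k
    have "sum g ({..<n} - {i} - {j}) = 0"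
    proof (intro sum.neutral ballI)
      fix k assume "k \<in> {..<n} - {i} - {j}"
      then have "cap n (x(k := x n)) y = 0"
        using ij Suc.prems by (intro Suc.IH[of i j]) auto
      then show "g k = 0" by (simp add: g_def)
    qed
    then have "sum g {..<n} = g i + g j"
      using ij Suc.prems sum.remove[of "{..<n}" i g] sum.remove[of "{..<n} - {i}" j g] by simp
    also have "\<dots> = c (x n) (x i) * x i * y (Suc n) + c (x i) (x n) * x i * y (Suc n)"
      unfolding g_def ci using Suc.prems(4) by simp
    also have "\<dots> = (c (x n) (x i) + c (x i) (x n)) * x i * y (Suc n)"
      by (simp add: algebra_simps)
    also have "\<dots> = 0" by (simp add: anti)
    finally have "(\<Sum>k<n. cap n (x(k := x n)) y * x k * y (Suc n)) = 0"
      by (simp add: g_def)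
    moreover have "cap n x y = 0"
      using ij Suc.prems by (intro Suc.IH[of i j]) auto
    ultimately show ?thesis by simp
  qed
qed simp

lemma cap_upd_eq: "i < n \<Longrightarrow> j < n \<Longrightarrow> cap n (x(i := x j)) y = (if i = j then cap n x y else 0)"
  using cap_alternating[of i n j "x(i := x j)" y] by auto

context prime_ideal
begin

text \<open>The operator \<open>r \<mapsto> cap n (x(j := r)) y\<close> sends \<open>x j\<close> to
  \<open>cap n x y\<close> and the other \<open>x i\<close> to 0. Applied to the right factors of
  the relation, it leaves only \<open>a j * q * cap n x y\<close>.\<close>

lemma cap_independent:
  assumes v: "cap n x y \<notin> P" and rel: "\<And>q. (\<Sum>i<n. a i * q * x i) \<in> P" and j: "j < n"
  shows "a j \<in> P"
proof (rule prime_right[OF v])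
  fix q
  obtain m :: nat and \<alpha> \<beta> where rep: "\<And>r. cap n (x(j := r)) y = (\<Sum>l<m. \<alpha> l * r * \<beta> l)"
    using elem_op_eq_sum[OF elem_op_cap[OF j, of x y]] by blast
  have "(\<Sum>l<m. (\<Sum>i<n. a i * (q * \<alpha> l) * x i) * \<beta> l) \<in> P"
    by (intro sum multr rel)
  also have "(\<Sum>l<m. (\<Sum>i<n. a i * (q * \<alpha> l) * x i) * \<beta> l) =
      (\<Sum>i<n. a i * q * cap n (x(j := x i)) y)"
    unfolding rep sum_distrib_left sum_distrib_right by (subst sum.swap) (simp add: mult.assoc)
  also have "\<dots> = (\<Sum>i<n. if i = j then a j * q * cap n x y else 0)"
    using j by (intro sum.cong) (auto simp: cap_upd_eq)
  finally show "a j * q * cap n x y \<in> P" using j by simp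
qed

end

section \<open>Coordinates and traces from a minimal Capelli identity\<close>

locale capelli = prime_ideal P for P :: "'a::ring set" +
  fixes t :: nat and x y :: "nat \<Rightarrow> 'a"
  assumes vanish: "\<And>x y. cap (Suc t) x y \<in> P"
    and nonzero: "cap t x y \<notin> P"
begin

definition v :: 'a where "v = cap t x y"

text \<open>Modulo \<open>P\<close>, the entries \<open>x 0, ..., x (t - 1)\<close> act as a basis
  over the extended centroid, and \<open>V i r\<close> is \<open>v\<close> times the
  \<open>i\<close>-th coordinate of \<open>r\<close>.\<close>

definition V :: "nat \<Rightarrow> 'a \<Rightarrow> 'a" where "V i r = cap t (x(i := r)) y"

lemma v: "v \<notin> P"
  using nonzero by (simp add: v_def)

lemma elem_op_V: "i < t \<Longrightarrow> elem_op (V i)"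
  using elem_op_cap[of i t x y] by (simp add: V_def[abs_def])

lemma V_x: "i < t \<Longrightarrow> j < t \<Longrightarrow> V i (x j) = (if i = j then v else 0)"
  by (simp add: V_def v_def cap_upd_eq)

lemma sum_V_x: "i < t \<Longrightarrow> (\<Sum>j<t. f j * V i (x j)) = f i * v"
  using sum.delta[of "{..<t}" i "\<lambda>j. f j * v"]
  by (simp add: V_x if_distrib[of "\<lambda>z. _ * z"] cong: if_cong)

text \<open>This is the expansion of \<open>cap (Suc t)\<close> at \<open>x(t := r)\<close> along
  its last entry. The factor \<open>q\<close> enters through \<open>y t\<close>, and the final
  factor \<open>s\<close> is removed by \<open>mult_cancel\<close>.\<close>

lemma cramer: "v * q * r - (\<Sum>i<t. V i r * q * x i) \<in> P"
proof (rule mult_cancel)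
  fix s
  define y' where "y' = y(t := y t * q, Suc t := s)"
  have "cap t x' y' = cap t x' (y(t := y t * q))" for x'
    by (rule cap_cong) (auto simp: y'_def)
  then have 1: "cap t x' y' = cap t x' y * q" for x'
    by (simp add: cap_last)
  have 2: "cap t (x(t := r)) y = cap t x y" by (rule cap_cong) auto
  have 3: "cap t (x(t := r, i := r)) y = cap t (x(i := r)) y" for i
    by (rule cap_cong) auto
  have "y' (Suc t) = s" by (simp add: y'_def)
  then have "cap (Suc t) (x(t := r)) y' = (v * q * r - (\<Sum>i<t. V i r * q * x i)) * s"
    by (intro trans[OF cap.simps(2)]) (simp add: 1 2 3 v_def V_def left_diff_distrib sum_distrib_right)
  then show "(v * q * r - (\<Sum>i<t. V i r * q * x i)) * s \<in> P"
    using vanish[of "x(t := r)" y'] by (simp only:)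
qed

text \<open>An elementary operator acts through coordinates: \<open>cramer\<close> with
  \<open>q * \<alpha> l\<close> for \<open>q\<close> is multiplied by \<open>\<beta> l\<close> on
  the right and summed over \<open>l\<close>.\<close>

lemma expand:
  assumes "elem_op g"
  shows "v * q * g r - (\<Sum>j<t. V j r * q * g (x j)) \<in> P"
proof -
  obtain m :: nat and \<alpha> \<beta> where rep: "\<And>r. g r = (\<Sum>l<m. \<alpha> l * r * \<beta> l)"
    using elem_op_eq_sum[OF assms] by blast
  have "(\<Sum>l<m. (v * (q * \<alpha> l) * r - (\<Sum>i<t. V i r * (q * \<alpha> l) * x i)) * \<beta> l) \<in> P"
    by (intro sum multr cramer)
  also have "(\<Sum>l<m. (v * (q * \<alpha> l) * r - (\<Sum>i<t. V i r * (q * \<alpha> l) * x i)) * \<beta> l) =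
      v * q * g r - (\<Sum>l<m. \<Sum>i<t. V i r * (q * \<alpha> l) * x i * \<beta> l)"
    by (simp add: rep sum_distrib_left sum_distrib_right left_diff_distrib sum_subtractf mult.assoc)
  also have "(\<Sum>l<m. \<Sum>i<t. V i r * (q * \<alpha> l) * x i * \<beta> l) = (\<Sum>j<t. V j r * q * g (x j))"
    unfolding rep sum_distrib_left by (subst sum.swap) (simp add: mult.assoc)
  finally show ?thesis .
qed

lemma V_commute_v: "i < t \<Longrightarrow> v * q * V i a - V i a * q * v \<in> P"
  using expand[OF elem_op_V, of i q a] by (simp add: sum_V_x)

text \<open>By \<open>V_commute_v\<close> every value of \<open>V i\<close> is proportional to
  \<open>v\<close> over the extended centroid. The three relations below carry out the exchange
  inside the ring.\<close>

lemma V_commute: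
  assumes "i < t" "j < t"
  shows "V j a * q * V i b - V i b * q * V j a \<in> P"
proof (rule prime'[OF v])
  fix s
  have 2: "v * (s * V j a * q) * V i b - V i b * (s * V j a * q) * v \<in> P"
    using assms by (intro V_commute_v)
  have 3: "V i b * s * (v * q * V j a - V j a * q * v) \<in> P"
    using assms by (intro multl V_commute_v)
  have 4: "(v * s * V i b - V i b * s * v) * (q * V j a) \<in> P"
    using assms by (intro multr V_commute_v)
  have "(v * (s * V j a * q) * V i b - V i b * (s * V j a * q) * v) -
      V i b * s * (v * q * V j a - V j a * q * v) -
      (v * s * V i b - V i b * s * v) * (q * V j a) \<in> P"
    using diff[OF diff[OF 2 3] 4] .
  then show "v * s * (V j a * q * V i b - V i b * q * V j a) \<in> P"
    by (simp add: algebra_simps)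
qed

text \<open>
  For a simple algebra of finite dimension \<open>t\<close> over its center, this is \<open>v\<close> times the trace of the
  linear map \<open>a \<mapsto> q a r\<close>.
\<close>

definition Tr :: "'a \<Rightarrow> 'a \<Rightarrow> 'a" where
  "Tr q r = (\<Sum>i<t. V i (q * x i * r))"

text \<open>The trace of a product of two maps, here \<open>a \<mapsto> w * a\<close> and
  \<open>a \<mapsto> q * a * r\<close>, does not depend on their order: in coordinates both traces
  give the same double sum up to the order of two \<open>V\<close> factors.\<close>

lemma Tr_commute: "Tr (w * q) r - Tr (q * w) r \<in> P"
proof (rule prime'[OF v])
  fix s
  have 1: "v * s * Tr (w * q) r - (\<Sum>i<t. \<Sum>j<t. V j (q * x i * r) * s * V i (w * x j)) \<in> P"
    unfolding Tr_def sum_distrib_left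
  proof (intro sum_diff)
    fix i assume "i \<in> {..<t}"
    then show "v * s * V i (w * q * x i * r) -
        (\<Sum>j<t. V j (q * x i * r) * s * V i (w * x j)) \<in> P"
      using expand[OF elem_op_sandwich(2)[OF elem_op_V], of i s w "q * x i * r"]
      by (simp add: mult.assoc)
  qed
  have 2: "v * s * Tr (q * w) r - (\<Sum>j<t. \<Sum>i<t. V i (w * x j) * s * V j (q * x i * r)) \<in> P"
    unfolding Tr_def sum_distrib_left
  proof (intro sum_diff)
    fix j assume "j \<in> {..<t}"
    then show "v * s * V j (q * w * x j * r) -
        (\<Sum>i<t. V i (w * x j) * s * V j (q * x i * r)) \<in> P"
      using expand[OF elem_op_sandwich(1)[OF elem_op_V, of j q r], of s "w * x j"]
      by (simp add: mult.assoc)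
  qed
  have 3: "(\<Sum>i<t. \<Sum>j<t. V j (q * x i * r) * s * V i (w * x j)) -
      (\<Sum>i<t. \<Sum>j<t. V i (w * x j) * s * V j (q * x i * r)) \<in> P"
    by (intro sum_diff V_commute) auto
  have swap: "(\<Sum>j<t. \<Sum>i<t. V i (w * x j) * s * V j (q * x i * r)) =
      (\<Sum>i<t. \<Sum>j<t. V i (w * x j) * s * V j (q * x i * r))"
    by (rule sum.swap)
  show "v * s * (Tr (w * q) r - Tr (q * w) r) \<in> P"
    using diff_trans[OF diff_trans[OF 1 3] diff_sym[OF 2[unfolded swap]]]
    by (simp add: right_diff_distrib)
qed

end

section \<open>Central elements\<close>

text \<open>If \<open>V i\<close> has the coefficients \<open>\<alpha> i l\<close> and
  \<open>\<beta> i l\<close>, then \<open>Tr q r\<close> is the sum of all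
  \<open>\<alpha> i l * q * (x i * r * \<beta> i l)\<close>; here the outer factors have changed
  places around \<open>s\<close>. \<open>P\<close> does not occur, so that one element can be
  examined modulo several prime ideals.\<close>

definition casimir ::
  "nat \<Rightarrow> (nat \<Rightarrow> 'a::ring) \<Rightarrow> (nat \<Rightarrow> nat) \<Rightarrow> (nat \<Rightarrow> nat \<Rightarrow> 'a) \<Rightarrow> (nat \<Rightarrow> nat \<Rightarrow> 'a) \<Rightarrow>
    'a \<Rightarrow> 'a \<Rightarrow> 'a" where
  "casimir t x m \<alpha> \<beta> r s = (\<Sum>i<t. \<Sum>l<m i. x i * r * \<beta> i l * s * \<alpha> i l)"

context capelli
begin

context
  fixes m :: "nat \<Rightarrow> nat" and \<alpha> \<beta> :: "nat \<Rightarrow> nat \<Rightarrow> 'a"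
  assumes rep: "\<And>i r. i < t \<Longrightarrow> V i r = (\<Sum>l<m i. \<alpha> i l * r * \<beta> i l)"
begin

text \<open>By \<open>flip\<close>, this is equivalent to \<open>Tr_commute\<close>.\<close>

lemma casimir_central: "casimir t x m \<alpha> \<beta> r s * w - w * casimir t x m \<alpha> \<beta> r s \<in> P"
proof -
  define J where "J = (SIGMA i:{..<t}. {..<m i})"
  \<comment> \<open>The sums in \<open>Tr (w * q) r\<close> and \<open>- Tr (q * w) r\<close> are
    merged into one family, tagged by a Boolean, so that \<open>flip\<close> applies.\<close>
  define a b where "a = (\<lambda>(k, i, l). if k then \<alpha> i l * w else - \<alpha> i l)"
    and "b = (\<lambda>(k, i, l). if k then x i * r * \<beta> i l else w * x i * r * \<beta> i l)"
  have split: "(\<Sum>p\<in>UNIV \<times> J. f p) = (\<Sum>i<t. \<Sum>l<m i. f (True, i, l) + f (False, i, l))"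
    for f :: "bool \<times> nat \<times> nat \<Rightarrow> 'a"
  proof -
    have "(\<Sum>p\<in>UNIV \<times> J. f p) = (\<Sum>k\<in>UNIV. \<Sum>p\<in>J. f (k, p))"
      by (simp add: sum.cartesian_product)
    also have "\<dots> = (\<Sum>p\<in>J. f (True, p) + f (False, p))"
      by (simp add: UNIV_bool sum.distrib add.commute)
    also have "\<dots> = (\<Sum>i<t. \<Sum>l<m i. f (True, i, l) + f (False, i, l))"
      by (simp add: J_def sum.Sigma)
    finally show ?thesis .
  qed
  have fin: "finite (UNIV \<times> J :: (bool \<times> nat \<times> nat) set)"
    by (simp add: J_def)
  have "(\<Sum>p\<in>UNIV \<times> J. a p * q * b p) \<in> P" for q
  proof -
    have "(\<Sum>p\<in>UNIV \<times> J. a p * q * b p) = Tr (w * q) r - Tr (q * w) r"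
      unfolding split Tr_def sum_subtractf[symmetric]
      by (intro sum.cong) (simp_all add: a_def b_def rep sum.distrib sum_subtractf mult.assoc)
    then show ?thesis using Tr_commute by simp
  qed
  then have "(\<Sum>p\<in>UNIV \<times> J. b p * s * a p) \<in> P"
    by (rule flip[OF fin])
  also have "(\<Sum>p\<in>UNIV \<times> J. b p * s * a p) =
      casimir t x m \<alpha> \<beta> r s * w - w * casimir t x m \<alpha> \<beta> r s"
    unfolding split casimir_def sum_distrib_left sum_distrib_right sum_subtractf[symmetric]
    by (intro sum.cong) (simp_all add: a_def b_def mult.assoc)
  finally show ?thesis .
qed

text \<open>The trace form is nondegenerate: if all these values lay in \<open>P\<close>, flipping
  would put every \<open>Tr q r\<close> into \<open>P\<close>, and then also \<open>v\<close>. The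
  factor \<open>s\<close> from \<open>I\<close> serves to place the element found in
  \<open>I\<close>.\<close>

lemma casimir_nonzero:
  assumes I: "\<And>a r. a \<in> I \<Longrightarrow> r * a \<in> I" "\<And>a r. a \<in> I \<Longrightarrow> a * r \<in> I" and e: "e \<in> I" "e \<notin> P"
  shows "\<exists>r s s'. s \<in> I \<and> casimir t x m \<alpha> \<beta> r (s * v * s') \<notin> P"
proof (rule ccontr)
  assume "\<not> ?thesis"
  then have z: "casimir t x m \<alpha> \<beta> r (s * v * s') \<in> P" if "s \<in> I" for r s s'
    using that by blast
  have Tr: "Tr q r \<in> P" for q r
  proof (rule prime'[OF v], rule prime'[OF e(2)])
    fix s p
    define J where "J = (SIGMA i:{..<t}. {..<m i})"
    define a where "a = (\<lambda>(i, l). x i * r * \<beta> i l)"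
    define b where "b = (\<lambda>(i, l). e * p * v * s * \<alpha> i l)"
    have J: "(\<Sum>k\<in>J. f k) = (\<Sum>i<t. \<Sum>l<m i. f (i, l))" for f :: "nat \<times> nat \<Rightarrow> 'a"
      by (simp add: J_def sum.Sigma)
    have "(\<Sum>k\<in>J. b k * q * a k) \<in> P"
    proof (rule flip)
      fix q'
      have "(\<Sum>k\<in>J. a k * q' * b k) = casimir t x m \<alpha> \<beta> r ((q' * e * p) * v * s)"
        by (simp add: J a_def b_def casimir_def mult.assoc)
      then show "(\<Sum>k\<in>J. a k * q' * b k) \<in> P"
        using z I e(1) by simp
    qed (simp add: J_def)
    also have "(\<Sum>k\<in>J. b k * q * a k) = e * p * (v * s * Tr q r)"
      by (simp add: J a_def b_def Tr_def rep sum_distrib_left mult.assoc)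
    finally show "e * p * (v * s * Tr q r) \<in> P" .
  qed
  have V: "V j (p * v * q) \<in> P" if j: "j < t" for j p q
  proof -
    \<comment> \<open>The sum is \<open>v\<close> times the trace of
      \<open>a \<mapsto> p * V j a * q\<close>, a map that sends \<open>x j\<close> to
      \<open>p * v * q\<close> and the other \<open>x i\<close> to 0.\<close>
    have "(\<Sum>l<m j. Tr (p * \<alpha> j l) (\<beta> j l * q)) \<in> P"
      by (intro sum Tr)
    also have "(\<Sum>l<m j. Tr (p * \<alpha> j l) (\<beta> j l * q)) =
        (\<Sum>i<t. V i (\<Sum>l<m j. p * (\<alpha> j l * x i * \<beta> j l) * q))"
      unfolding Tr_def by (subst sum.swap) (simp add: elem_op_of_sum[OF elem_op_V] mult.assoc)
    also have "\<dots> = (\<Sum>i<t. if i = j then V j (p * v * q) else 0)"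
    proof (intro sum.cong refl)
      fix i assume "i \<in> {..<t}"
      then have i: "i < t" by simp
      have "(\<Sum>l<m j. p * (\<alpha> j l * x i * \<beta> j l) * q) = p * V j (x i) * q"
        by (simp add: rep[OF j] sum_distrib_left sum_distrib_right)
      then show "V i (\<Sum>l<m j. p * (\<alpha> j l * x i * \<beta> j l) * q) =
          (if i = j then V j (p * v * q) else 0)"
        using i j by (auto simp: V_x elem_op_0[OF elem_op_V])
    qed
    finally show ?thesis using j by simp
  qed
  \<comment> \<open>All coordinates of \<open>p * v * p'\<close> lie in \<open>P\<close>, so
    \<open>cramer\<close> leaves only its first term.\<close>
  have "v * q * (p * v * p') \<in> P" for q p p'
  proof -
    have "(\<Sum>i<t. V i (p * v * p') * q * x i) \<in> P"
      by (rule sum) (rule multr[OF multr[OF V]], simp)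
    then show ?thesis
      using diff_iff[OF cramer[of q "p * v * p'"]] by blast
  qed
  then have "p * v * p' \<in> P" for p p'
    using prime'[OF v] by blast
  then have "p * v \<in> P" for p
    using mult_cancel[of "p * v"] by blast
  then show False
    using prime[of v v] v by blast
qed

end

end

text \<open>The operators \<open>r \<mapsto> cap t (x(i := r)) y\<close> are written out
  independently of the prime ideal, so one Casimir value serves every \<open>P'\<close>. If
  \<open>v\<close> lies in \<open>P'\<close>, so does each summand, which has \<open>v\<close> as a
  factor; otherwise \<open>casimir_central\<close> applies to \<open>P'\<close>.\<close>

lemma central_element:
  fixes P I :: "'a::ring set"
  assumes P: "prime_ideal P" and vanish: "\<And>x y. cap (Suc t) x y \<in> P" and nonzero: "cap t x y \<notin> P"
    and I: "two_sided_ideal (*) I" "e \<in> I" "e \<notin> P"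
  shows "\<exists>z\<in>I. z \<notin> P \<and> (\<forall>P'. prime_ideal P' \<longrightarrow> (\<forall>x y. cap (Suc t) x y \<in> P') \<longrightarrow>
    z \<in> P' \<or> (\<forall>w. z * w - w * z \<in> P'))"
proof -
  define R :: "nat \<Rightarrow> nat \<times> (nat \<Rightarrow> 'a) \<times> (nat \<Rightarrow> 'a) \<Rightarrow> bool" where
    "R = (\<lambda>i (m, \<alpha>, \<beta>). \<forall>r. cap t (x(i := r)) y = (\<Sum>l<m. \<alpha> l * r * \<beta> l))"
  have "\<exists>k. R i k" if "i < t" for i
    using elem_op_eq_sum[OF elem_op_cap[OF that, of x y]] by (auto simp: R_def)
  then obtain k where "\<And>i. i < t \<Longrightarrow> R i (k i)"
    by metis
  moreover define m \<alpha> \<beta> where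
    "m = (\<lambda>i. fst (k i))" and "\<alpha> = (\<lambda>i. fst (snd (k i)))" and "\<beta> = (\<lambda>i. snd (snd (k i)))"
  ultimately have rep: "cap t (x(i := r)) y = (\<Sum>l<m i. \<alpha> i l * r * \<beta> i l)" if "i < t" for i r
    using that by (simp add: R_def split_beta)
  define v where "v = cap t x y"
  have I': "r * a \<in> I" "a * r \<in> I" "0 \<in> I" if "a \<in> I" for a r
    using I(1) that by (auto simp: two_sided_ideal_def left_ideal_def)
  have I_sum: "sum f A \<in> I" if "\<And>i. i \<in> A \<Longrightarrow> f i \<in> I" for f :: "nat \<Rightarrow> 'a" and A
    using that
  proof (induction A rule: infinite_finite_induct)
    case (insert a A)
    have "f a - (0 - sum f A) \<in> I"
      using I(1) insert I'(3)[OF I(2)] unfolding two_sided_ideal_def left_ideal_def by blast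
    then show ?case using insert by simp
  qed (use I'(3)[OF I(2)] in auto)
  have "capelli P t x y"
    using P vanish nonzero by (simp add: capelli_def capelli_axioms_def)
  then interpret C: capelli P t x y .
  have "C.V i r = (\<Sum>l<m i. \<alpha> i l * r * \<beta> i l)" if "i < t" for i r
    using that rep by (simp add: C.V_def)
  from C.casimir_nonzero[OF this I'(1) I'(2) I(2,3)] obtain r s s' where
    z: "s \<in> I" "casimir t x m \<alpha> \<beta> r (s * v * s') \<notin> P"
    unfolding C.v_def v_def by blast
  have "casimir t x m \<alpha> \<beta> r (s * v * s') \<in> I"
    unfolding casimir_def by (intro I_sum) (rule I'(2)[OF I'(1)[OF I'(2)[OF I'(2)[OF z(1)]]]])
  moreover have "casimir t x m \<alpha> \<beta> r (s * v * s') \<in> P' \<or>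
      (\<forall>w. casimir t x m \<alpha> \<beta> r (s * v * s') * w - w * casimir t x m \<alpha> \<beta> r (s * v * s') \<in> P')"
    if P': "prime_ideal P'" "\<forall>x y. cap (Suc t) x y \<in> P'" for P'
  proof (cases "v \<in> P'")
    case True
    interpret P': prime_ideal P' by (rule P')
    show ?thesis
      unfolding casimir_def
      by (intro disjI1 P'.sum) (rule P'.multr[OF P'.multl[OF P'.multr[OF P'.multl[OF True]]]])
  next
    case False
    then have "capelli P' t x y"
      using P' by (simp add: capelli_def capelli_axioms_def v_def)
    then interpret C': capelli P' t x y .
    have "C'.V i r = (\<Sum>l<m i. \<alpha> i l * r * \<beta> i l)" if "i < t" for i r
      using that rep by (simp add: C'.V_def)
    from C'.casimir_central[OF this] show ?thesis by blast
  qed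
  ultimately show ?thesis using z(2) by blast
qed

section \<open>Words with separated letters\<close>

text \<open>The list is read from right to left, so the last factor corresponds to its head.\<close>

fun sparse_word :: "(nat \<Rightarrow> 'a::ring) \<Rightarrow> (nat \<Rightarrow> 'a) \<Rightarrow> nat list \<Rightarrow> 'a" where
  "sparse_word x y [] = y 0"
| "sparse_word x y (i # is) = sparse_word x y is * x i * y (Suc (length is))"

text \<open>Letters may repeat because the proof of independence removes letters one at a time over
  a fixed alphabet.\<close>

definition sparse_identity :: "'a::ring itself \<Rightarrow> nat \<Rightarrow> (nat list \<Rightarrow> int) \<Rightarrow> bool" where
  "sparse_identity _ n c \<longleftrightarrow> (\<forall>x y :: nat \<Rightarrow> 'a.
     (\<Sum>is | set is \<subseteq> {..<n} \<and> length is = n. int_scale (c is) (sparse_word x y is)) = 0)"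

lemma sparse_word_cong: "(\<And>i. i \<le> length is \<Longrightarrow> y i = y' i) \<Longrightarrow> sparse_word x y is = sparse_word x y' is"
  by (induction "is") auto

lemma sparse_word_last: "sparse_word x (y(length is := y (length is) * q)) is = sparse_word x y is * q"
proof (cases "is")
  case (Cons i js)
  have "sparse_word x (y(Suc (length js) := z)) js = sparse_word x y js" for z
    by (rule sparse_word_cong) auto
  then show ?thesis by (simp add: Cons mult.assoc)
qed simp

text \<open>The head of the list is the last letter. The entry of \<open>y\<close> behind it is
  removed by \<open>mult_cancel\<close>, an arbitrary \<open>q\<close> is inserted before it through
  \<open>y k\<close>, and \<open>cap_independent\<close> then separates the words by this
  letter.\<close>

lemma (in prime_ideal) sparse_words_independent:
  assumes v: "cap n x y0 \<notin> P"
    and "\<And>y. (\<Sum>is | set is \<subseteq> {..<n} \<and> length is = k. int_scale (c is) (sparse_word x y is)) \<in> P"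
    and "set is \<subseteq> {..<n}" "length is = k"
  shows "int_scale (c is) r \<in> P"
  using assms(2-)
proof (induction k arbitrary: c "is")
  case 0
  have "{is. set is \<subseteq> {..<n} \<and> length is = 0} = {[]}" by auto
  then show ?case using 0(1)[of "\<lambda>_. r"] 0(3) by simp
next
  case (Suc k)
  define L where "L = {is. set is \<subseteq> {..<n} \<and> length is = k}"
  have fin: "finite L" unfolding L_def by (rule finite_lists_length_eq) simp
  obtain i js where "is": "is = i # js" "i < n" "set js \<subseteq> {..<n}" "length js = k"
    using Suc.prems(2,3) by (cases "is") auto
  define h where "h y i = (\<Sum>is\<in>L. int_scale (c (i # is)) (sparse_word x y is))" for y i
  have eq: "{is. set is \<subseteq> {..<n} \<and> length is = Suc k} = (\<lambda>(i, is). i # is) ` ({..<n} \<times> L)"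
    by (auto simp: L_def length_Suc_conv image_iff)
  have inj: "inj_on (\<lambda>(i, is). i # is) ({..<n} \<times> L)"
    by (auto simp: inj_on_def)
  have sum_eq: "(\<Sum>is | set is \<subseteq> {..<n} \<and> length is = Suc k. int_scale (c is) (sparse_word x y is)) =
      (\<Sum>i<n. h y i * x i) * y (Suc k)" for y
  proof -
    have "(\<Sum>is | set is \<subseteq> {..<n} \<and> length is = Suc k. int_scale (c is) (sparse_word x y is)) =
        (\<Sum>i<n. \<Sum>is\<in>L. int_scale (c (i # is)) (sparse_word x y is * x i * y (Suc (length is))))"
      unfolding eq sum.reindex[OF inj] sum.cartesian_product by (simp add: split_beta)
    also have "\<dots> = (\<Sum>i<n. \<Sum>is\<in>L. int_scale (c (i # is)) (sparse_word x y is) * x i * y (Suc k))"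
      by (intro sum.cong refl) (simp add: L_def int_scale_mult_left)
    finally show ?thesis by (simp add: h_def sum_distrib_right)
  qed
  have h: "(\<Sum>i<n. h y i * x i) \<in> P" for y
  proof (rule mult_cancel)
    fix r
    have upd: "h (y(Suc k := r)) i = h y i" for i
      unfolding h_def by (intro sum.cong refl arg_cong[of _ _ "int_scale _"] sparse_word_cong)
        (auto simp: L_def)
    then show "(\<Sum>i<n. h y i * x i) * r \<in> P"
      using Suc.prems(1)[of "y(Suc k := r)"] unfolding sum_eq upd by simp
  qed
  have "h y i \<in> P" for y
  proof (rule cap_independent[OF v _ \<open>i < n\<close>])
    fix q
    have upd: "h (y(k := y k * q)) i = h y i * q" for i
      unfolding h_def sum_distrib_right
      by (intro sum.cong refl) (auto simp: L_def int_scale_mult_left sparse_word_last)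
    then show "(\<Sum>i<n. h y i * q * x i) \<in> P"
      using h[of "y(k := y k * q)"] unfolding upd by blast
  qed
  then show ?case
    using Suc.IH[of "\<lambda>is. c (i # is)" js] "is" by (simp add: h_def L_def)
qed

text \<open>Otherwise every coefficient \<open>c is\<close> would map the ring into
  \<open>P\<close>, and so would the combination of coefficients equal to 1.\<close>

lemma (in prime_ideal) cap_in_P:
  assumes sparse: "sparse_identity TYPE('a) n c"
    and primitive: "(\<Sum>is | set is \<subseteq> {..<n} \<and> length is = n. u is * c is) = 1"
  shows "cap n x y \<in> P"
proof (rule ccontr)
  assume v: "cap n x y \<notin> P"
  define L where "L = {is. set is \<subseteq> {..<n} \<and> length is = n}"
  have scale: "int_scale (c is) r \<in> P" if "is \<in> L" for "is" r
    by (rule sparse_words_independent[OF v, where k = n])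
      (use sparse that in \<open>simp_all add: sparse_identity_def L_def\<close>)
  have "r \<in> P" for r
  proof -
    have "(\<Sum>is\<in>L. int_scale (c is) (int_scale (u is) r)) \<in> P"
      by (intro sum scale)
    also have "(\<Sum>is\<in>L. int_scale (c is) (int_scale (u is) r)) = int_scale (\<Sum>is\<in>L. u is * c is) r"
      by (simp add: int_scale_sum_left int_scale_mult[symmetric] mult.commute)
    finally show ?thesis using primitive by (simp add: L_def)
  qed
  then show False using proper by blast
qed

lemma (in prime_ideal) exists_capelli:
  assumes "sparse_identity TYPE('a) n c"
    and "(\<Sum>is | set is \<subseteq> {..<n} \<and> length is = n. u is * c is) = 1"
  shows "\<exists>t x y. (\<forall>x y. cap (Suc t) x y \<in> P) \<and> cap t x y \<notin> P"
proof -
  \<comment> \<open>The witness is the predecessor \<open>s\<close> of this number, which exists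
    since \<open>cap 0\<close> takes every value.\<close>
  define t where "t = (LEAST n. \<forall>x y. cap n x y \<in> P)"
  have t: "\<forall>x y. cap t x y \<in> P"
    unfolding t_def by (rule LeastI[of _ n]) (simp add: cap_in_P[OF assms])
  have "t \<noteq> 0"
  proof
    assume "t = 0"
    then have "a \<in> P" for a using t spec[of _ "\<lambda>_. a"] by (metis cap.simps(1))
    then show False using proper by blast
  qed
  then obtain s where s: "t = Suc s" by (cases t) auto
  have "\<not> (\<forall>x y. cap s x y \<in> P)"
    using not_less_Least[of s "\<lambda>n. \<forall>x y. cap n x y \<in> P"] s by (simp add: t_def[symmetric])
  with t s show ?thesis by blast
qed

section \<open>Multilinear identities\<close>

lemma eval_word_append:
  "u \<noteq> [] \<Longrightarrow> w \<noteq> [] \<Longrightarrow> eval_word v (u @ w) = eval_word v u * eval_word v w"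
proof (induction v u rule: eval_word.induct)
  case (2 v i)
  then show ?case by (cases w) auto
qed (auto simp: mult.assoc)

definition multilinear_identity :: "'a::ring itself \<Rightarrow> nat \<Rightarrow> (nat list \<Rightarrow> int) \<Rightarrow> bool" where
  "multilinear_identity _ d c \<longleftrightarrow> (\<forall>v :: nat \<Rightarrow> 'a.
     (\<Sum>js\<in>permutations_of_set {..<d}. int_scale (c js) (eval_word v js)) = 0)"

lemma eval_word_sum:
  fixes Y :: "nat \<Rightarrow> 'a::ring"
  assumes "finite A" "u \<noteq> []"
  shows "eval_word (\<lambda>i. \<Sum>j | j \<in> A \<and> w ! j = i. Y j) u =
    (\<Sum>js | set js \<subseteq> A \<and> map ((!) w) js = u. eval_word Y js)"
  using assms(2)
proof (induction u rule: induct_list012)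
  case (2 i)
  have "{js. set js \<subseteq> A \<and> map ((!) w) js = [i]} = (\<lambda>j. [j]) ` {j. j \<in> A \<and> w ! j = i}"
    by (auto simp: map_eq_Cons_conv image_iff)
  then show ?case by (simp add: sum.reindex inj_on_def)
next
  case (3 i k u)
  define B where "B = {j. j \<in> A \<and> w ! j = i}"
  define L where "L = {js. set js \<subseteq> A \<and> map ((!) w) js = k # u}"
  have eq: "{js. set js \<subseteq> A \<and> map ((!) w) js = i # k # u} = (\<lambda>(j, js). j # js) ` (B \<times> L)"
    unfolding B_def L_def
  proof (intro set_eqI iffI)
    fix js assume "js \<in> {js. set js \<subseteq> A \<and> map ((!) w) js = i # k # u}"
    then show "js \<in> (\<lambda>(j, js). j # js) `
        ({j. j \<in> A \<and> w ! j = i} \<times> {js. set js \<subseteq> A \<and> map ((!) w) js = k # u})"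
      by (cases js) auto
  qed auto
  have inj: "inj_on (\<lambda>(j, js). j # js) (B \<times> L)"
    by (auto simp: inj_on_def)
  have "(\<Sum>js | set js \<subseteq> A \<and> map ((!) w) js = i # k # u. eval_word Y js) =
      (\<Sum>j\<in>B. \<Sum>js\<in>L. eval_word Y (j # js))"
    unfolding eq sum.reindex[OF inj] sum.cartesian_product by (simp add: split_beta)
  also have "\<dots> = (\<Sum>j\<in>B. \<Sum>js\<in>L. Y j * eval_word Y js)"
  proof (intro sum.cong refl)
    fix j js assume "js \<in> L"
    then show "eval_word Y (j # js) = Y j * eval_word Y js"
      by (cases js) (auto simp: L_def)
  qed
  also have "\<dots> = (\<Sum>j\<in>B. Y j) * (\<Sum>js\<in>L. eval_word Y js)"
    by (simp add: sum_product)
  finally show ?case using 3 by (simp add: B_def L_def)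
qed simp

text \<open>
  For a monic identity with leading word \<open>w\<close> of length \<open>d\<close>, substitute for \<open>X\<^sub>i\<close> the sum of those
  among new variables \<open>Y\<^sub>0, \<dots>, Y\<^bsub>d - 1\<^esub>\<close> whose index is a position of \<open>i\<close> in \<open>w\<close>,
  and take the part involving all new variables.
\<close>

lemma pi_ring_multilinear:
  assumes "pi_ring TYPE('a::ring)"
  shows "\<exists>d c. d > 0 \<and> c [0..<d] = 1 \<and> multilinear_identity TYPE('a) d c"
proof -
  obtain f w where nil: "[] \<notin> Poly_Mapping.keys f"
    and w: "Poly_Mapping.lookup f w = 1" "\<And>u. u \<in> Poly_Mapping.keys f \<Longrightarrow> length u \<le> length w"
    and f: "\<And>v :: nat \<Rightarrow> 'a. eval_ncpoly v f = 0"
    using assms by (auto simp: pi_ring_def monic_ncpoly_def)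
  define d where "d = length w"
  define c where "c js = Poly_Mapping.lookup f (map ((!) w) js)" for js
  have "w \<in> Poly_Mapping.keys f"
    using w(1) by (simp add: in_keys_iff)
  then have "d > 0" using nil by (cases w) (auto simp: d_def)
  moreover have "c [0..<d] = 1"
    using w(1) by (simp add: c_def d_def map_nth)
  moreover have "multilinear_identity TYPE('a) d c"
    unfolding multilinear_identity_def
  proof
    fix Y :: "nat \<Rightarrow> 'a"
    define g where "g js = int_scale (c js) (eval_word Y js)" for js
    define L where "L = {js. set js \<subseteq> {..<d} \<and> map ((!) w) js \<in> Poly_Mapping.keys f}"
    have L_length: "length js \<le> d" if "js \<in> L" for js
      using w(2)[of "map ((!) w) js"] that by (auto simp: L_def d_def)
    have finL: "finite L"
      by (rule finite_subset[OF _ finite_lists_length_le[of "{..<d}" d]])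
        (use L_length in \<open>auto simp: L_def\<close>)
    have sub: "(\<Sum>js | js \<in> L \<and> set js \<subseteq> A. g js) = 0" if A: "A \<subseteq> {..<d}" for A
    proof -
      have finA: "finite A" using A finite_subset by blast
      define v where "v i = (\<Sum>j | j \<in> A \<and> w ! j = i. Y j)" for i
      have "0 = eval_ncpoly v f" by (simp add: f)
      also have "\<dots> = (\<Sum>u\<in>Poly_Mapping.keys f.
          \<Sum>js | js \<in> {js. js \<in> L \<and> set js \<subseteq> A} \<and> map ((!) w) js = u. g js)"
        unfolding eval_ncpoly_def
      proof (intro sum.cong refl)
        fix u assume u: "u \<in> Poly_Mapping.keys f"
        then have "u \<noteq> []" using nil by auto
        have "int_scale (Poly_Mapping.lookup f u) (eval_word v u) =
            (\<Sum>js | set js \<subseteq> A \<and> map ((!) w) js = u.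
              int_scale (Poly_Mapping.lookup f u) (eval_word Y js))"
          unfolding v_def eval_word_sum[OF finA \<open>u \<noteq> []\<close>] int_scale_sum_right ..
        also have "\<dots> = (\<Sum>js | js \<in> {js. js \<in> L \<and> set js \<subseteq> A} \<and> map ((!) w) js = u. g js)"
          by (rule sum.cong) (use u A in \<open>auto simp: L_def g_def c_def\<close>)
        finally show "int_scale (Poly_Mapping.lookup f u) (eval_word v u) = \<dots>" .
      qed
      also have "\<dots> = (\<Sum>js | js \<in> L \<and> set js \<subseteq> A. g js)"
      proof (rule sum.group)
        show "finite {js. js \<in> L \<and> set js \<subseteq> A}"
          by (rule finite_subset[OF _ finL]) auto
      qed (auto simp: L_def)
      finally show ?thesis by simp
    qed
    \<comment> \<open>By induction the contributions of the proper subsets of \<open>A\<close>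
      vanish, which leaves the words that use all variables in \<open>A\<close>.\<close>
    have exact: "(\<Sum>js | js \<in> L \<and> set js = A. g js) = 0" if "A \<subseteq> {..<d}" for A
      using finite_subset[OF that finite_lessThan] that
    proof (induction A rule: finite_psubset_induct)
      case (psubset A)
      have "0 = (\<Sum>js | js \<in> L \<and> set js \<subseteq> A. g js)"
        using sub[OF psubset.prems] by simp
      also have "\<dots> = (\<Sum>B\<in>Pow A. \<Sum>js | js \<in> {js. js \<in> L \<and> set js \<subseteq> A} \<and> set js = B. g js)"
        by (rule sum.group[symmetric]) (use finL psubset.hyps in auto)
      also have "\<dots> = (\<Sum>B\<in>Pow A. if B = A then \<Sum>js | js \<in> L \<and> set js = A. g js else 0)"
      proof (intro sum.cong refl)
        fix B assume B: "B \<in> Pow A"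
        then have "{js. js \<in> {js. js \<in> L \<and> set js \<subseteq> A} \<and> set js = B} = {js. js \<in> L \<and> set js = B}"
          by auto
        then show "(\<Sum>js | js \<in> {js. js \<in> L \<and> set js \<subseteq> A} \<and> set js = B. g js) =
            (if B = A then \<Sum>js | js \<in> L \<and> set js = A. g js else 0)"
          using psubset.IH[of B] psubset.prems B by auto
      qed
      finally show ?case using psubset.hyps by simp
    qed
    have "(\<Sum>js\<in>permutations_of_set {..<d}. g js) = (\<Sum>js | js \<in> L \<and> set js = {..<d}. g js)"
    proof (rule sum.mono_neutral_right)
      \<comment> \<open>No word of \<open>f\<close> is longer than \<open>w\<close>, so a word that
        uses all \<open>d\<close> variables uses each of them once.\<close>
      show "{js. js \<in> L \<and> set js = {..<d}} \<subseteq> permutations_of_set {..<d}"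
      proof safe
        fix js assume js: "js \<in> L" "set js = {..<d}"
        then have "card (set js) \<ge> length js" using L_length by simp
        then have "distinct js" by (simp add: card_distinct card_length le_antisym)
        with js show "js \<in> permutations_of_set {..<d}" by (simp add: permutations_of_set_def)
      qed
      show "\<forall>js\<in>permutations_of_set {..<d} - {js. js \<in> L \<and> set js = {..<d}}. g js = 0"
      proof
        fix js assume "js \<in> permutations_of_set {..<d} - {js. js \<in> L \<and> set js = {..<d}}"
        then have "map ((!) w) js \<notin> Poly_Mapping.keys f"
          unfolding L_def permutations_of_set_def by blast
        then show "g js = 0" by (simp add: g_def c_def in_keys_iff)
      qed
    qed simp
    then show "(\<Sum>js\<in>permutations_of_set {..<d}. int_scale (c js) (eval_word Y js)) = 0"
      using exact[of "{..<d}"] by (simp add: g_def)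
  qed
  ultimately show ?thesis by blast
qed

section \<open>Latyshev's lemma\<close>

lemma subseq_imp_split:
  "subseq ds xs \<Longrightarrow> \<exists>w0 ws. xs = w0 @ concat ws \<and> map hd ws = ds \<and> [] \<notin> set ws"
proof (induction rule: list_emb.induct)
  case (list_emb_Nil ys)
  then show ?case by (intro exI[of _ ys] exI[of _ "[]"]) simp
next
  case (list_emb_Cons xs ys y)
  then obtain w0 ws where "ys = w0 @ concat ws" "map hd ws = xs" "[] \<notin> set ws" by blast
  then show ?case by (intro exI[of _ "y # w0"] exI[of _ ws]) simp
next
  case (list_emb_Cons2 x y xs ys)
  then obtain w0 ws where "ys = w0 @ concat ws" "map hd ws = xs" "[] \<notin> set ws" by blast
  then show ?case using list_emb_Cons2 by (intro exI[of _ "[]"] exI[of _ "(y # w0) # ws"]) simp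
qed

lemma mset_perm: "js \<in> permutations_of_set {..<d} \<Longrightarrow> mset js = mset [0..<d]"
  using set_eq_iff_mset_eq_distinct[of js "[0..<d]"]
  by (simp add: permutations_of_set_def lessThan_atLeast0)

text \<open>Where \<open>js\<close> first departs from the identity, the smaller indices are used
  up, so a later block stands there, and its head is smaller. As \<open>lex\<close> compares lists
  of equal length, the lengths are checked too.\<close>

lemma permuted_concat_less:
  fixes ws :: "nat list list"
  assumes dec: "sorted_wrt (>) (map hd ws)" and ne: "[] \<notin> set ws"
    and js: "js \<in> permutations_of_set {..<length ws}" "js \<noteq> [0..<length ws]"
  shows "(w0 @ concat (map ((!) ws) js), w0 @ concat ws) \<in> lex less_than"
proof -
  define d where "d = length ws"
  have len: "length js = length [0..<d]"
    using js(1) by (simp add: d_def length_finite_permutations_of_set)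
  have perm: "set js = {..<d}" "distinct js"
    using js(1) by (auto simp: d_def permutations_of_set_def)
  obtain pre x xs y ys where xy: "x \<noteq> y" "js = pre @ [x] @ xs" "[0..<d] = pre @ [y] @ ys"
    using same_length_different[OF _ len] js(2) d_def by blast
  have "y = [0..<d] ! length pre" by (simp add: xy(3))
  moreover have "length pre < d"
    using arg_cong[OF xy(3), of length] by simp
  ultimately have y: "y = length pre" "y < d" by auto
  have "pre = take (length pre) [0..<d]" by (simp add: xy(3))
  then have "set pre = {..<y}"
    using y by (metis add_0 atLeast_upt less_imp_le take_upt)
  moreover have "x \<notin> set pre" "x < d"
    using perm xy(2) by auto
  ultimately have "y < x" using xy(1) by (simp add: not_less[symmetric])
  have concat_ws: "concat ws = concat (map ((!) ws) [0..<d])" by (simp add: d_def map_nth)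
  have hds: "ws ! k = hd (ws ! k) # tl (ws ! k)" if "k < d" for k
    using ne that by (metis d_def list.exhaust_sel nth_mem)
  have less: "hd (ws ! x) < hd (ws ! y)"
    using sorted_wrt_nth_less[OF dec, of y x] \<open>y < x\<close> \<open>x < d\<close> by (simp add: d_def)
  have eq1: "w0 @ concat (map ((!) ws) js) = (w0 @ concat (map ((!) ws) pre)) @
      hd (ws ! x) # (tl (ws ! x) @ concat (map ((!) ws) xs))"
    using hds[OF \<open>x < d\<close>] by (simp add: xy(2))
  have eq2: "w0 @ concat ws = (w0 @ concat (map ((!) ws) pre)) @
      hd (ws ! y) # (tl (ws ! y) @ concat (map ((!) ws) ys))"
    unfolding concat_ws using hds[OF \<open>y < d\<close>] by (simp add: xy(3))
  have "length (concat (map ((!) ws) js)) = length (concat ws)"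
  proof -
    have "mset js = mset [0..<d]"
      unfolding d_def by (rule mset_perm[OF js(1)])
    then have "mset (map (length \<circ> (!) ws) js) = mset (map (length \<circ> (!) ws) [0..<d])"
      by simp
    then have "sum_list (map (length \<circ> (!) ws) js) = sum_list (map (length \<circ> (!) ws) [0..<d])"
      by (metis sum_mset_sum_list)
    then show ?thesis
      unfolding concat_ws by (simp add: length_concat comp_def)
  qed
  then have "length (w0 @ concat (map ((!) ws) js)) = length (w0 @ concat ws)"
    by simp
  then show ?thesis
    unfolding eq1 eq2 using less by (intro lex_append_leftI) simp
qed

definition good_word :: "nat \<Rightarrow> nat list \<Rightarrow> bool" where
  "good_word d xs \<longleftrightarrow> (\<forall>ds. subseq ds xs \<longrightarrow> sorted_wrt (>) ds \<longrightarrow> length ds < d)"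

definition good_perms :: "nat \<Rightarrow> nat \<Rightarrow> nat list set" where
  "good_perms d N = {xs \<in> permutations_of_set {..<N}. good_word d xs}"

lemma finite_good_perms: "finite (good_perms d N)"
  by (simp add: good_perms_def)

lemma eval_word_concat:
  assumes "[] \<notin> set ws"
  shows "js \<noteq> [] \<Longrightarrow> set js \<subseteq> {..<length ws} \<Longrightarrow>
    eval_word (\<lambda>i. eval_word v (ws ! i)) js = eval_word v (concat (map ((!) ws) js))"
proof (induction js rule: induct_list012)
  case (3 i k js)
  then have "ws ! i \<noteq> []" "ws ! k \<noteq> []"
    using assms by (metis insert_subset lessThan_iff list.simps(15) nth_mem)+
  then show ?case
    using 3 eval_word_append[of "ws ! i" "ws ! k @ concat (map ((!) ws) js)" v] by simp
qed auto

lemma permuted_concat_perm: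
  assumes "w0 @ concat ws \<in> permutations_of_set A" "js \<in> permutations_of_set {..<length ws}"
  shows "w0 @ concat (map ((!) ws) js) \<in> permutations_of_set A"
proof -
  have "mset js = mset [0..<length ws]"
    by (rule mset_perm[OF assms(2)])
  then have "mset (map (mset \<circ> (!) ws) js) = mset (map (mset \<circ> (!) ws) [0..<length ws])"
    by simp
  then have "sum_list (map (mset \<circ> (!) ws) js) = sum_list (map (mset \<circ> (!) ws) [0..<length ws])"
    by (metis sum_mset_sum_list)
  then have "mset (concat (map ((!) ws) js)) = mset (concat (map ((!) ws) [0..<length ws]))"
    by (simp add: mset_concat comp_def)
  then have "mset (w0 @ concat (map ((!) ws) js)) = mset (w0 @ concat ws)"
    by (simp add: map_nth)
  then show ?thesis
    using assms(1) mset_eq_setD mset_eq_imp_distinct_iff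
    unfolding permutations_of_set_def mem_Collect_eq by metis
qed

text \<open>A word that is not good splits into a prefix and \<open>d\<close> blocks with decreasing
  heads. Substituting the blocks in the multilinear identity replaces the word by a combination of
  lexicographically smaller permutations.\<close>

lemma latyshev:
  fixes c :: "nat list \<Rightarrow> int"
  assumes ml: "multilinear_identity TYPE('a::ring) d c" and c: "c [0..<d] = 1" and d: "d > 0"
  shows "xs \<in> permutations_of_set {..<N} \<Longrightarrow> \<exists>k. \<forall>v :: nat \<Rightarrow> 'a.
    eval_word v xs = (\<Sum>ys\<in>good_perms d N. int_scale (k ys) (eval_word v ys))"
proof (induction xs rule: wf_induct_rule[OF wf_lex[OF wf_less_than]])
  case (1 xs)
  show ?case
  proof (cases "good_word d xs")
    case True
    then have xs: "xs \<in> good_perms d N" using 1(2) by (simp add: good_perms_def)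
    have "eval_word v xs =
        (\<Sum>ys\<in>good_perms d N. int_scale (if ys = xs then 1 else 0) (eval_word v ys))" for v :: "nat \<Rightarrow> 'a"
    proof -
      have "(\<Sum>ys\<in>good_perms d N. int_scale (if ys = xs then 1 else 0) (eval_word v ys)) =
          (\<Sum>ys\<in>good_perms d N. if ys = xs then eval_word v xs else 0)"
        by (intro sum.cong) auto
      then show ?thesis using xs finite_good_perms by simp
    qed
    then show ?thesis by (intro exI[of _ "\<lambda>ys. if ys = xs then 1 else 0"] allI)
  next
    case False
    then obtain ds where ds: "subseq ds xs" "sorted_wrt (>) ds" "d \<le> length ds"
      by (auto simp: good_word_def not_less)
    have "subseq (take d ds) xs"
      using ds(1) prefix_imp_subseq[OF take_is_prefix] subseq_order.trans by blast
    then obtain w0 ws where ws: "xs = w0 @ concat ws" "map hd ws = take d ds" "[] \<notin> set ws"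
      using subseq_imp_split by blast
    have len: "length ws = d"
      using arg_cong[OF ws(2), of length] ds(3) by simp
    have dec: "sorted_wrt (>) (map hd ws)"
      unfolding ws(2) using ds(2) by (rule sorted_wrt_take)
    define Q where "Q = permutations_of_set {..<d}"
    define W where "W js = w0 @ concat (map ((!) ws) js)" for js
    have id: "[0..<d] \<in> Q"
      by (auto simp: Q_def permutations_of_set_def)
    have W_id: "W [0..<d] = xs"
      unfolding W_def ws(1) len[symmetric] by (simp add: map_nth)
    have finQ: "finite Q" by (simp add: Q_def)
    have "eval_word v xs = (\<Sum>js\<in>Q - {[0..<d]}. int_scale (- c js) (eval_word v (W js)))"
      for v :: "nat \<Rightarrow> 'a"
    proof -
      have js: "js \<noteq> []" "set js = {..<d}" "concat (map ((!) ws) js) \<noteq> []" if "js \<in> Q" for js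
      proof -
        show set: "set js = {..<d}" using that by (auto simp: Q_def permutations_of_set_def)
        from d have 0: "0 \<in> set js" by (simp add: set)
        then show "js \<noteq> []" by force
        have "ws ! 0 \<in> set ws" using d len by simp
        then have "ws ! 0 \<noteq> []" using ws(3) by metis
        then show "concat (map ((!) ws) js) \<noteq> []"
          using 0 by (auto simp: concat_eq_Nil_conv)
      qed
      have "0 = (\<Sum>js\<in>Q. int_scale (c js) (eval_word (\<lambda>i. eval_word v (ws ! i)) js))"
        using ml by (simp add: multilinear_identity_def Q_def)
      also have "\<dots> = (\<Sum>js\<in>Q. int_scale (c js) (eval_word v (concat (map ((!) ws) js))))"
        using js len by (intro sum.cong refl) (simp add: eval_word_concat[OF ws(3)])
      finally have eq: "(\<Sum>js\<in>Q. int_scale (c js) (eval_word v (concat (map ((!) ws) js)))) = 0" ..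
      have "(\<Sum>js\<in>Q. int_scale (c js) (eval_word v (W js))) = 0"
      \<comment> \<open>\<open>eval_word\<close> is 0 on the empty word, so an empty prefix cannot
        be split off as a factor.\<close>
      proof (cases "w0 = []")
        case True
        then show ?thesis using eq by (simp add: W_def)
      next
        case False
        have "(\<Sum>js\<in>Q. int_scale (c js) (eval_word v (W js))) = eval_word v w0 *
            (\<Sum>js\<in>Q. int_scale (c js) (eval_word v (concat (map ((!) ws) js))))"
          unfolding sum_distrib_left
          by (intro sum.cong refl)
            (simp only: W_def eval_word_append[OF False js(3)] int_scale_mult_right)
        then show ?thesis using eq by simp
      qed
      then have "eval_word v xs + (\<Sum>js\<in>Q - {[0..<d]}. int_scale (c js) (eval_word v (W js))) = 0"
        by (simp add: sum.remove[OF finQ id] c W_id)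
      then show ?thesis
        by (simp add: int_scale_uminus sum_negf eq_neg_iff_add_eq_0)
    qed
    moreover have "\<exists>k. \<forall>v :: nat \<Rightarrow> 'a.
        eval_word v (W js) = (\<Sum>ys\<in>good_perms d N. int_scale (k ys) (eval_word v ys))"
      if "js \<in> Q - {[0..<d]}" for js
    proof (rule "1.IH")
      show "(W js, xs) \<in> lex less_than"
        unfolding W_def ws(1) using that len
        by (intro permuted_concat_less dec ws(3)) (auto simp: Q_def)
      show "W js \<in> permutations_of_set {..<N}"
        unfolding W_def using that len 1(2) ws(1) by (intro permuted_concat_perm) (auto simp: Q_def)
    qed
    then have "\<forall>js\<in>Q - {[0..<d]}. \<exists>k. \<forall>v :: nat \<Rightarrow> 'a.
        eval_word v (W js) = (\<Sum>ys\<in>good_perms d N. int_scale (k ys) (eval_word v ys))"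
      by blast
    from bchoice[OF this] obtain K where K: "\<And>js v :: nat \<Rightarrow> 'a. js \<in> Q - {[0..<d]} \<Longrightarrow>
        eval_word v (W js) = (\<Sum>ys\<in>good_perms d N. int_scale (K js ys) (eval_word v ys))"
      by blast
    ultimately have "eval_word v xs = (\<Sum>ys\<in>good_perms d N.
        int_scale (\<Sum>js\<in>Q - {[0..<d]}. - c js * K js ys) (eval_word v ys))" for v :: "nat \<Rightarrow> 'a"
      unfolding int_scale_sum_left by (subst sum.swap)
        (simp add: K int_scale_sum_right int_scale_mult[symmetric])
    then show ?thesis 
      by (intro exI[of _ "\<lambda>ys. \<Sum>js\<in>Q - {[0..<d]}. - c js * K js ys"] allI)
  qed
qed

section \<open>Counting words without long decreasing subsequences\<close>

definition desc_chains :: "nat list \<Rightarrow> nat \<Rightarrow> nat list set" where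
  "desc_chains xs a = {ds. subseq (ds @ [a]) xs \<and> sorted_wrt (>) (ds @ [a])}"

text \<open>\<open>desc_chains\<close> leaves out the final letter, so the values start at 0 and a
  good word needs only \<open>d - 1\<close> of them.\<close>

definition chain_length :: "nat list \<Rightarrow> nat \<Rightarrow> nat" where
  "chain_length xs a = Max (length ` desc_chains xs a)"

lemma finite_desc_chains: "finite (desc_chains xs a)"
proof (rule finite_subset)
  show "desc_chains xs a \<subseteq> butlast ` set (subseqs xs)"
    by (auto simp: desc_chains_def intro!: image_eqI[of _ _ "_ @ [a]"])
qed simp

lemma chain_length_attained:
  assumes "a \<in> set xs"
  shows "\<exists>ds\<in>desc_chains xs a. length ds = chain_length xs a"
proof -
  have "[] \<in> desc_chains xs a"
    using assms by (simp add: desc_chains_def subseq_singleton_left)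
  then have "chain_length xs a \<in> length ` desc_chains xs a"
    unfolding chain_length_def using finite_desc_chains[of xs a] by (intro Max_in) auto
  then show ?thesis by force
qed

lemma chain_length_less:
  assumes "good_word d xs" "a \<in> set xs"
  shows "chain_length xs a < d - 1"
proof -
  obtain ds where ds: "ds \<in> desc_chains xs a" "length ds = chain_length xs a"
    using chain_length_attained[OF assms(2)] by blast
  then have "length (ds @ [a]) < d"
    using assms(1) unfolding good_word_def desc_chains_def by blast
  with ds(2) show ?thesis by simp
qed

lemma chain_length_increasing:
  assumes xs: "xs = p @ a # q @ b # r" "distinct xs" and "b < a"
  shows "chain_length xs a < chain_length xs b"
proof -
  obtain ds where ds: "subseq (ds @ [a]) xs" "sorted_wrt (>) (ds @ [a])" "length ds = chain_length xs a"
    using chain_length_attained[of a xs] xs(1) by (auto simp: desc_chains_def)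
  have "xs = (p @ [a]) @ (q @ b # r)" by (simp add: xs(1))
  with ds(1) obtain us vs where uv: "ds @ [a] = us @ vs" "subseq us (p @ [a])" "subseq vs (q @ b # r)"
    by (metis subseq_appendE)
  \<comment> \<open>Since \<open>a\<close> occurs only once in \<open>xs\<close>, a chain ending in
    \<open>a\<close> lies entirely before \<open>q\<close> and can be extended by
    \<open>b\<close>.\<close>
  have "vs = []"
  proof (rule ccontr)
    assume "vs \<noteq> []"
    then have "a \<in> set vs" using uv(1) by (metis last_appendR last_in_set last_snoc)
    then have "subseq [a] vs" by (simp add: subseq_singleton_left)
    then have "subseq [a] (q @ b # r)" using uv(3) by (rule subseq_order.trans)
    then have "a \<in> set (q @ b # r)" by (simp only: subseq_singleton_left)
    then show False using xs by auto
  qed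
  then have "subseq (ds @ [a]) (p @ [a])" using uv by simp
  moreover have "subseq [b] (q @ b # r)" by (simp add: subseq_singleton_left)
  ultimately have "subseq ((ds @ [a]) @ [b]) ((p @ [a]) @ (q @ b # r))"
    by (rule list_emb_append_mono)
  then have "ds @ [a] \<in> desc_chains xs b"
    using ds(2) \<open>b < a\<close> by (auto simp: desc_chains_def xs(1) sorted_wrt_append)
  then have "length (ds @ [a]) \<le> chain_length xs b"
    unfolding chain_length_def by (intro Max_ge finite_imageI imageI finite_desc_chains)
  with ds(3) show ?thesis by simp
qed

lemma sorted_wrtI_split:
  "(\<And>p a q b r. xs = p @ a # q @ b # r \<Longrightarrow> R a b) \<Longrightarrow> sorted_wrt R xs"
proof (induction xs)
  case (Cons x xs)
  have "R x b" if "b \<in> set xs" for b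
    using split_list[OF that] Cons.prems[of "[]" x _ b] by force
  moreover have "sorted_wrt R xs"
  proof (rule Cons.IH)
    fix p a q b r assume "xs = p @ a # q @ b # r"
    then show "R a b" using Cons.prems[of "x # p" a q b r] by simp
  qed
  ultimately show ?case by simp
qed simp

text \<open>The colours \<open>map g xs\<close> tell from which colour class the next letter is
  taken, and the filters list each class in order.\<close>

lemma eq_if_filters_eq:
  "map g xs = map g ys \<Longrightarrow> (\<And>k. filter (\<lambda>a. g a = k) xs = filter (\<lambda>a. g a = k) ys) \<Longrightarrow> xs = ys"
proof (induction xs arbitrary: ys)
  case (Cons x xs)
  then obtain y ys' where ys: "ys = y # ys'" "g x = g y" "map g xs = map g ys'"
    by (cases ys) auto
  have "x = y"
    using Cons.prems(2)[of "g x"] ys by simp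
  moreover have "filter (\<lambda>a. g a = k) xs = filter (\<lambda>a. g a = k) ys'" for k
    using Cons.prems(2)[of k] ys \<open>x = y\<close> by (cases "g x = k") auto
  then have "xs = ys'" using Cons.IH ys(3) by blast
  ultimately show ?case using ys by simp
qed simp

text \<open>
  Colour each letter of a good word by the length of the longest decreasing chain that it ends. Letters
  of the same colour appear in increasing order, so the word is determined by the colours of
  its positions and of its letters.
\<close>

lemma card_good_perms: "card (good_perms d N) \<le> (d - 1) ^ (2 * N)"
proof -
  define T where "T = {ys. set ys \<subseteq> {..<d - 1} \<and> length ys = N}"
  define \<Phi> where "\<Phi> xs = (map (chain_length xs) xs, map (chain_length xs) [0..<N])" for xs
  have perm: "set xs = {..<N}" "distinct xs" "length xs = N" "good_word d xs"
    if "xs \<in> good_perms d N" for xs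
    using that length_finite_permutations_of_set[of xs "{..<N}"]
    by (auto simp: good_perms_def permutations_of_set_def)
  have "inj_on \<Phi> (good_perms d N)"
  proof (rule inj_onI)
    fix xs ys assume xs: "xs \<in> good_perms d N" and ys: "ys \<in> good_perms d N" and eq: "\<Phi> xs = \<Phi> ys"
    define g where "g = chain_length xs"
    have "chain_length ys a = g a" if "a < N" for a
      using eq that by (simp add: \<Phi>_def g_def)
    then have g: "chain_length ys a = g a" if "a \<in> set ys" for a
      using that perm(1)[OF ys] by simp
    then have "map (chain_length ys) ys = map g ys"
      by simp
    then have "map g xs = map g ys"
      using eq by (simp add: \<Phi>_def g_def)
    have incr: "sorted_wrt (<) (filter (\<lambda>a. g a = k) zs)"
      if zs: "zs \<in> good_perms d N" "\<And>a. a \<in> set zs \<Longrightarrow> chain_length zs a = g a" for zs k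
    proof -
      have "sorted_wrt (\<lambda>a b. g a = g b \<longrightarrow> a < b) zs"
      proof (rule sorted_wrtI_split, rule impI)
        fix p a q b r assume *: "zs = p @ a # q @ b # r" "g a = g b"
        then have "chain_length zs a = chain_length zs b" using zs(2) by simp
        then have "\<not> b < a" using chain_length_increasing[OF *(1) perm(2)[OF zs(1)]] by auto
        moreover have "a \<noteq> b" using *(1) perm(2)[OF zs(1)] by auto
        ultimately show "a < b" by simp
      qed
      then have "sorted_wrt (\<lambda>a b. g a = g b \<longrightarrow> a < b) (filter (\<lambda>a. g a = k) zs)"
        by (rule sorted_wrt_filter)
      then show ?thesis
        by (rule sorted_wrt_mono_rel[rotated]) auto
    qed
    have "filter (\<lambda>a. g a = k) xs = filter (\<lambda>a. g a = k) ys" for k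
      using incr[OF xs] incr[OF ys g] perm(1)[OF xs] perm(1)[OF ys]
      by (intro strict_sorted_equal) (auto simp: g_def)
    with \<open>map g xs = map g ys\<close> show "xs = ys"
      by (rule eq_if_filters_eq)
  qed
  moreover have "\<Phi> ` good_perms d N \<subseteq> T \<times> T"
  proof
    fix z assume "z \<in> \<Phi> ` good_perms d N"
    then obtain xs where xs: "xs \<in> good_perms d N" "z = \<Phi> xs" by blast
    show "z \<in> T \<times> T"
      using chain_length_less[OF perm(4)[OF xs(1)]] perm(1,3)[OF xs(1)] xs(2)
      by (auto simp: \<Phi>_def T_def)
  qed
  moreover have "finite (T \<times> T)"
    unfolding T_def by (intro finite_cartesian_product finite_lists_length_eq) auto
  ultimately have "card (good_perms d N) \<le> card (T \<times> T)"
    by (rule card_inj_on_le)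
  also have "\<dots> = (d - 1) ^ (2 * N)"
    by (simp add: T_def card_cartesian_product card_lists_length_eq power_add[symmetric] mult_2)
  finally show ?thesis .
qed

section \<open>Identities among words with separated letters\<close>

text \<open>Gaussian elimination without division: an index \<open>k\<close> with
  \<open>a k j\<close> nonzero is the pivot, and cross-multiplication removes the equation
  \<open>j\<close>.\<close>

lemma int_linear_dependence:
  fixes a :: "'i \<Rightarrow> 'j \<Rightarrow> int"
  assumes "finite J" "finite I" "card J < card I"
  shows "\<exists>c. (\<exists>i\<in>I. c i \<noteq> 0) \<and> (\<forall>j\<in>J. (\<Sum>i\<in>I. c i * a i j) = 0)"
  using assms
proof (induction J arbitrary: I a rule: finite_induct)
  case empty
  then have "I \<noteq> {}" by auto
  then show ?case by (intro exI[of _ "\<lambda>_. 1"]) auto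
next
  case (insert j J)
  show ?case
  proof (cases "\<forall>i\<in>I. a i j = 0")
    case True
    obtain c where "\<exists>i\<in>I. c i \<noteq> 0" "\<forall>j\<in>J. (\<Sum>i\<in>I. c i * a i j) = 0"
      using insert.IH[of I a] insert.prems insert.hyps by auto
    with True show ?thesis by (intro exI[of _ c]) simp
  next
    case False
    then obtain k where k: "k \<in> I" "a k j \<noteq> 0" by blast
    define a' where "a' i l = a k j * a i l - a i j * a k l" for i l
    have "card J < card (I - {k})"
      using insert.prems insert.hyps k by simp
    then obtain c where c: "\<exists>i\<in>I - {k}. c i \<noteq> 0" "\<forall>l\<in>J. (\<Sum>i\<in>I - {k}. c i * a' i l) = 0"
      using insert.IH[of "I - {k}" a'] insert.prems by blast
    define b where "b i = (if i = k then - (\<Sum>i\<in>I - {k}. c i * a i j) else a k j * c i)" for i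
    have sum_b: "(\<Sum>i\<in>I. b i * a i l) = (\<Sum>i\<in>I - {k}. c i * a' i l)" for l
    proof -
      have "(\<Sum>i\<in>I. b i * a i l) = b k * a k l + (\<Sum>i\<in>I - {k}. b i * a i l)"
        using insert.prems(1) k(1) by (rule sum.remove)
      also have "(\<Sum>i\<in>I - {k}. b i * a i l) = (\<Sum>i\<in>I - {k}. a k j * c i * a i l)"
        by (intro sum.cong) (auto simp: b_def)
      also have "b k = - (\<Sum>i\<in>I - {k}. c i * a i j)" by (simp add: b_def)
      also have "- (\<Sum>i\<in>I - {k}. c i * a i j) * a k l + (\<Sum>i\<in>I - {k}. a k j * c i * a i l) =
          (\<Sum>i\<in>I - {k}. c i * a' i l)"
        by (simp add: a'_def sum_distrib_left sum_subtractf right_diff_distrib mult_ac)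
      finally show ?thesis .
    qed
    have "(\<Sum>i\<in>I. b i * a i l) = 0" if "l \<in> insert j J" for l
      unfolding sum_b using that c(2) by (auto simp: a'_def mult.commute)
    moreover have "\<exists>i\<in>I. b i \<noteq> 0"
      using c(1) k(2) by (auto simp: b_def)
    ultimately show ?thesis by blast
  qed
qed

lemma bezout_finite:
  fixes c :: "'i \<Rightarrow> int"
  assumes "finite I"
  shows "\<exists>u. (\<Sum>i\<in>I. u i * c i) = Gcd (c ` I)"
  using assms
proof induction
  case (insert i I)
  then obtain u where u: "(\<Sum>i\<in>I. u i * c i) = Gcd (c ` I)" by blast
  obtain s t where st: "s * c i + t * Gcd (c ` I) = gcd (c i) (Gcd (c ` I))"
    using bezout_int by blast
  have "(\<Sum>k\<in>I. (if k = i then s else t * u k) * c k) = t * (\<Sum>k\<in>I. u k * c k)"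
    unfolding sum_distrib_left using insert.hyps by (intro sum.cong) auto
  then have "(\<Sum>k\<in>insert i I. (if k = i then s else t * u k) * c k) = Gcd (c ` insert i I)"
    using insert.hyps u st by simp
  then show ?case by (rule exI[of _ "\<lambda>k. if k = i then s else t * u k"])
qed simp

text \<open>Dividing by the gcd makes the coefficients jointly coprime, so that they cannot all
  annihilate a nonzero ring, whatever its characteristic.\<close>

lemma int_primitive_dependence:
  fixes a :: "'i \<Rightarrow> 'j \<Rightarrow> int"
  assumes "finite J" "finite I" "card J < card I"
  shows "\<exists>c u. (\<Sum>i\<in>I. u i * c i) = 1 \<and> (\<forall>j\<in>J. (\<Sum>i\<in>I. c i * a i j) = 0)"
proof -
  obtain c where c: "\<exists>i\<in>I. c i \<noteq> 0" "\<And>j. j \<in> J \<Longrightarrow> (\<Sum>i\<in>I. c i * a i j) = 0"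
    using int_linear_dependence[OF assms] by blast
  define g where "g = Gcd (c ` I)"
  have "g \<noteq> 0" using c(1) by (auto simp: g_def)
  define c' where "c' i = c i div g" for i
  have c': "c i = g * c' i" if "i \<in> I" for i
    using that by (simp add: c'_def g_def)
  obtain u where "(\<Sum>i\<in>I. u i * c i) = g"
    using bezout_finite[OF assms(2)] g_def by blast
  then have "g * (\<Sum>i\<in>I. u i * c' i) = g"
    unfolding sum_distrib_left using c' by (simp add: mult.left_commute)
  then have "(\<Sum>i\<in>I. u i * c' i) = 1" using \<open>g \<noteq> 0\<close> by simp
  moreover have "(\<Sum>i\<in>I. c' i * a i j) = 0" if "j \<in> J" for j
  proof -
    have "g * (\<Sum>i\<in>I. c' i * a i j) = 0"
      unfolding sum_distrib_left using c' c(2)[OF that] by (simp add: mult.assoc)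
    then show ?thesis using \<open>g \<noteq> 0\<close> by simp
  qed
  ultimately show ?thesis by blast
qed

text \<open>Odd letters stand for the \<open>x i\<close> and even letters for the
  \<open>y j\<close>, so a word with separated letters becomes a permutation.\<close>

fun interleave :: "nat list \<Rightarrow> nat list" where
  "interleave [] = [0]"
| "interleave (i # is) = interleave is @ [2 * i + 1, 2 * Suc (length is)]"

lemma eval_word_interleave:
  "eval_word v (interleave is) = sparse_word (\<lambda>i. v (2 * i + 1)) (\<lambda>j. v (2 * j)) is"
proof (induction "is")
  case (Cons i "is")
  have "interleave is \<noteq> []" by (cases "is") auto
  with Cons show ?case by (simp add: eval_word_append mult.assoc)
qed simp

lemma interleave_perm:
  assumes "is \<in> permutations_of_set {..<n}"
  shows "interleave is \<in> permutations_of_set {..<2 * n + 1}"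
proof -
  have len: "length is = n" and set_is: "set is = {..<n}"
    using assms length_finite_permutations_of_set[of "is" "{..<n}"]
    by (auto simp: permutations_of_set_def)
  have "set (interleave is) = (\<lambda>i. 2 * i + 1) ` set is \<union> (\<lambda>j. 2 * j) ` {..length is}" for "is"
    by (induction "is") (auto simp: atMost_Suc)
  then have "set (interleave is) = (\<lambda>i. 2 * i + 1) ` {..<n} \<union> (\<lambda>j. 2 * j) ` {..n}"
    by (simp add: len set_is)
  also have "\<dots> = {..<2 * n + 1}"
  proof safe
    fix k assume k: "k < 2 * n + 1" "k \<notin> (\<lambda>j. 2 * j) ` {..n}"
    then have "odd k" by (auto elim!: evenE)
    then show "k \<in> (\<lambda>i. 2 * i + 1) ` {..<n}"
      using k(1) by (auto elim!: oddE)
  qed auto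
  finally have set: "set (interleave is) = {..<2 * n + 1}" .
  have "length (interleave is) = 2 * length is + 1" for "is"
    by (induction "is") auto
  then have "card (set (interleave is)) = length (interleave is)"
    by (simp add: set len)
  then show ?thesis
    using set by (simp add: permutations_of_set_def card_distinct)
qed

text \<open>The terms of an exponential series tend to 0. The exponent is twice the word length
  \<open>2 * n + 1\<close>, as in \<open>card_good_perms\<close>.\<close>

lemma exists_fact_greater: "\<exists>n. K ^ (4 * n + 2) < (fact n :: nat)"
proof -
  define x where "x = real K ^ 4"
  have "(\<lambda>n. real K ^ 2 * (x ^ n /\<^sub>R fact n)) \<longlonglongrightarrow> real K ^ 2 * 0"
    by (intro tendsto_mult_left summable_LIMSEQ_zero summable_exp_generic)
  then have "\<forall>\<^sub>F n in sequentially. real K ^ 2 * (x ^ n /\<^sub>R fact n) < 1"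
    by (intro order_tendstoD(2)[where a = 1]) auto
  then obtain n where "real K ^ 2 * (x ^ n /\<^sub>R fact n) < 1"
    using eventually_happens sequentially_bot by blast
  then have "real K ^ 2 * x ^ n < fact n"
    by (simp add: field_simps)
  also have "real K ^ 2 * x ^ n = real (K ^ (4 * n + 2))"
    by (simp add: x_def power_add power_mult power2_eq_square)
  finally have "real (K ^ (4 * n + 2)) < real (fact n)" by simp
  then have "K ^ (4 * n + 2) < fact n" by (simp only: of_nat_less_iff)
  then show ?thesis by blast
qed

lemma pi_ring_sparse_identity:
  assumes "pi_ring TYPE('a::ring)"
  shows "\<exists>n c u. sparse_identity TYPE('a) n c \<and>
    (\<Sum>is | set is \<subseteq> {..<n} \<and> length is = n. u is * c is) = 1"
proof -
  obtain d c0 where ml: "d > 0" "c0 [0..<d] = 1" "multilinear_identity TYPE('a) d c0"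
    using pi_ring_multilinear[OF assms] by blast
  obtain n where n: "(d - 1) ^ (4 * n + 2) < (fact n :: nat)"
    using exists_fact_greater by blast
  define N where "N = 2 * n + 1"
  define I where "I = permutations_of_set {..<n}"
  define L where "L = {is. set is \<subseteq> {..<n} \<and> length is = n}"
  have "\<forall>is\<in>I. \<exists>k. \<forall>v :: nat \<Rightarrow> 'a. eval_word v (interleave is) =
      (\<Sum>ys\<in>good_perms d N. int_scale (k ys) (eval_word v ys))"
    using latyshev[OF ml(3,2,1) interleave_perm] by (simp add: I_def N_def)
  from bchoice[OF this] obtain k where k: "\<And>is v :: nat \<Rightarrow> 'a. is \<in> I \<Longrightarrow> eval_word v (interleave is) =
      (\<Sum>ys\<in>good_perms d N. int_scale (k is ys) (eval_word v ys))"
    by blast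
  have "2 * N = 4 * n + 2" by (simp add: N_def)
  \<comment> \<open>There are more interleaved permutations than good words spanning them, which
    forces a relation among their coefficient vectors.\<close>
  then have "card (good_perms d N) < card I"
    using card_good_perms[of d N] n by (simp add: I_def)
  then obtain c u where cu: "(\<Sum>is\<in>I. u is * c is) = 1"
    and c: "\<And>ys. ys \<in> good_perms d N \<Longrightarrow> (\<Sum>is\<in>I. c is * k is ys) = 0"
    using int_primitive_dependence[of "good_perms d N" I k] finite_good_perms by (auto simp: I_def)
  define c' where "c' is = (if is \<in> I then c is else 0)" for "is"
  have finL: "finite L" unfolding L_def by (rule finite_lists_length_eq) simp
  have IL: "I \<subseteq> L"
  proof
    fix js assume "js \<in> I"
    then show "js \<in> L"
      using length_finite_permutations_of_set[of js "{..<n}"]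
      by (simp add: I_def L_def permutations_of_set_def)
  qed
  have "sparse_identity TYPE('a) n c'"
    unfolding sparse_identity_def
  proof (intro allI)
    fix x y :: "nat \<Rightarrow> 'a"
    define v where "v k = (if even k then y (k div 2) else x (k div 2))" for k
    have v: "sparse_word x y is = eval_word v (interleave is)" for "is"
      unfolding eval_word_interleave by (simp add: v_def)
    have "(\<Sum>is\<in>L. int_scale (c' is) (sparse_word x y is)) =
        (\<Sum>is\<in>I. int_scale (c is) (sparse_word x y is))"
      using finL IL by (intro sum.mono_neutral_cong_right) (auto simp: c'_def)
    also have "\<dots> = (\<Sum>is\<in>I. \<Sum>ys\<in>good_perms d N. int_scale (c is * k is ys) (eval_word v ys))"
      by (intro sum.cong refl) (simp add: v k int_scale_sum_right int_scale_mult)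
    also have "\<dots> = (\<Sum>ys\<in>good_perms d N. int_scale (\<Sum>is\<in>I. c is * k is ys) (eval_word v ys))"
      unfolding int_scale_sum_left by (rule sum.swap)
    also have "\<dots> = 0" by (simp add: c)
    finally show "(\<Sum>is | set is \<subseteq> {..<n} \<and> length is = n. int_scale (c' is) (sparse_word x y is)) = 0"
      by (simp add: L_def)
  qed
  moreover have "(\<Sum>is\<in>L. u is * c' is) = (\<Sum>is\<in>I. u is * c is)"
    using finL IL by (intro sum.mono_neutral_cong_right) (auto simp: c'_def)
  ultimately show ?thesis using cu unfolding L_def by metis
qed

section \<open>The Jacobson radical of a ring given by its multiplication\<close>

locale ring_mult =
  fixes m :: "'b::ab_group_add \<Rightarrow> 'b \<Rightarrow> 'b"
  assumes assoc: "m (m x y) z = m x (m y z)"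
    and distrib_left: "m x (y + z) = m x y + m x z"
    and distrib_right: "m (x + y) z = m x z + m y z"
begin

lemma zero_left [simp]: "m 0 x = 0"
  using distrib_right[of 0 0 x] by simp

lemma zero_right [simp]: "m x 0 = 0"
  using distrib_left[of x 0 0] by simp

lemma minus_left: "m (- x) y = - m x y"
  using distrib_right[of x "- x" y] by (simp add: eq_neg_iff_add_eq_0 add.commute)

lemma minus_right: "m x (- y) = - m x y"
  using distrib_left[of x y "- y"] by (simp add: eq_neg_iff_add_eq_0 add.commute)

lemma diff_left: "m (x - y) z = m x z - m y z"
  using distrib_right[of x "- y" z] by (simp add: minus_left)

lemma diff_right: "m x (y - z) = m x y - m x z"
  using distrib_left[of x y "- z"] by (simp add: minus_right)

lemma left_ideal_uminus: "left_ideal m I \<Longrightarrow> x \<in> I \<Longrightarrow> - x \<in> I"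
  unfolding left_ideal_def by (metis diff_0)

lemma left_ideal_add: "left_ideal m I \<Longrightarrow> x \<in> I \<Longrightarrow> y \<in> I \<Longrightarrow> x + y \<in> I"
  unfolding left_ideal_def by (metis diff_0 diff_minus_eq_add)

lemma left_ideal_jacobson_radical: "left_ideal m (jacobson_radical m)"
  unfolding jacobson_radical_def left_ideal_def modular_left_ideal_def by blast

text \<open>The left ideal \<open>L\<close> of all \<open>x - m x f\<close> has \<open>f\<close> as
  a right identity modulo it. If \<open>L\<close> is proper, Zorn's lemma enlarges it to a modular
  maximal left ideal without \<open>f\<close>, against the choice of \<open>f\<close>.\<close>

lemma left_quasi_regular:
  assumes f: "f \<in> jacobson_radical m"
  shows "\<exists>x. x - m x f = g"
proof -
  define L where "L = range (\<lambda>x. x - m x f)"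
  have L: "left_ideal m L"
    unfolding left_ideal_def
  proof (intro conjI ballI allI)
    show "0 \<in> L"
      unfolding L_def by (rule range_eqI[of _ _ 0]) simp
    fix x y s assume "x \<in> L" "y \<in> L"
    then obtain x' y' where x: "x = x' - m x' f" "y = y' - m y' f"
      by (auto simp: L_def)
    show "x - y \<in> L"
      unfolding L_def by (rule range_eqI[of _ _ "x' - y'"]) (simp add: x diff_left algebra_simps)
    show "m s x \<in> L"
      unfolding L_def by (rule range_eqI[of _ _ "m s x'"]) (simp add: x diff_right assoc)
  qed
  have "L = UNIV"
  proof (rule ccontr)
    assume "L \<noteq> UNIV"
    \<comment> \<open>Above \<open>L\<close>, being proper thus means omitting \<open>f\<close>, a
      condition that survives unions of chains.\<close>
    have everything: "I = UNIV" if "left_ideal m I" "L \<subseteq> I" "f \<in> I" for I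
    proof -
      have "x \<in> I" for x
      proof -
        have "x - m x f \<in> I" "m x f \<in> I"
          using that by (auto simp: L_def left_ideal_def)
        from left_ideal_add[OF that(1) this] show ?thesis by simp
      qed
      then show ?thesis by blast
    qed
    define \<A> where "\<A> = {I. left_ideal m I \<and> L \<subseteq> I \<and> f \<notin> I}"
    have "L \<in> \<A>"
      using L \<open>L \<noteq> UNIV\<close> everything by (auto simp: \<A>_def)
    have "\<exists>M\<in>\<A>. \<forall>I\<in>\<A>. M \<subseteq> I \<longrightarrow> I = M"
    proof (rule subset_Zorn_nonempty)
      show "\<A> \<noteq> {}" using \<open>L \<in> \<A>\<close> by blast
      fix \<C> assume C: "\<C> \<noteq> {}" "subset.chain \<A> \<C>"
      then have sub: "\<And>I. I \<in> \<C> \<Longrightarrow> left_ideal m I \<and> L \<subseteq> I \<and> f \<notin> I"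
        by (auto simp: subset.chain_def \<A>_def)
      have "left_ideal m (\<Union>\<C>)"
        unfolding left_ideal_def
      proof (intro conjI ballI allI)
        show "0 \<in> \<Union>\<C>" using C(1) sub by (auto simp: left_ideal_def)
        fix x y s assume "x \<in> \<Union>\<C>" "y \<in> \<Union>\<C>"
        then obtain I K where IK: "I \<in> \<C>" "x \<in> I" "K \<in> \<C>" "y \<in> K" by blast
        have "I \<subseteq> K \<or> K \<subseteq> I"
          using C(2) IK by (auto simp: subset.chain_def)
        with IK obtain H where "H \<in> \<C>" "x \<in> H" "y \<in> H" by blast
        then show "x - y \<in> \<Union>\<C>" using sub unfolding left_ideal_def by blast
        show "m s x \<in> \<Union>\<C>" using sub IK unfolding left_ideal_def by blast
      qed
      then show "\<Union>\<C> \<in> \<A>"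
        using C(1) sub by (auto simp: \<A>_def)
    qed
    then obtain M where M: "left_ideal m M" "L \<subseteq> M" "f \<notin> M"
      and max: "\<And>I. I \<in> \<A> \<Longrightarrow> M \<subseteq> I \<Longrightarrow> I = M"
      by (auto simp: \<A>_def)
    have "maximal_left_ideal m M"
      unfolding maximal_left_ideal_def
    proof (intro conjI allI impI)
      fix I assume "left_ideal m I" "M \<subseteq> I"
      then show "I = M \<or> I = UNIV"
        using max[of I] everything[of I] M by (auto simp: \<A>_def)
    qed (use M in auto)
    moreover have "m x f - x \<in> M" for x
    proof -
      have "x - m x f \<in> M" using M(2) by (auto simp: L_def)
      from left_ideal_uminus[OF M(1) this] show ?thesis by simp
    qed
    then have "modular_left_ideal m M"
      using M by (auto simp: modular_left_ideal_def)
    ultimately have "f \<in> M"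
      using f by (auto simp: jacobson_radical_def)
    with M show False by blast
  qed
  then have "g \<in> L" by simp
  then show ?thesis by (auto simp: L_def)
qed

text \<open>With a formal 1, \<open>1 + q\<close> is a left inverse of \<open>1 - f\<close> and has
  a left inverse \<open>1 + p\<close> itself, since \<open>q\<close> lies in the radical. Hence
  \<open>p = - f\<close>, and the inverse is two-sided.\<close>

lemma quasi_inverse:
  assumes f: "f \<in> jacobson_radical m"
  shows "\<exists>q. q = f + m f q"
proof -
  obtain q where q: "q - m q f = f"
    using left_quasi_regular[OF f] by blast
  then have "q = f + m q f" by (simp add: algebra_simps)
  moreover have "f + m q f \<in> jacobson_radical m"
    using f left_ideal_jacobson_radical left_ideal_add by (auto simp: left_ideal_def)
  ultimately have "- q \<in> jacobson_radical m"
    using left_ideal_uminus[OF left_ideal_jacobson_radical, of q] by simp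
  then obtain p where "p - m p (- q) = - q"
    using left_quasi_regular by blast
  then have p: "p + q + m p q = 0"
    by (simp add: minus_right) (metis add.commute add.left_commute add.right_inverse)
  have "m p (q - f - m q f) = 0"
    using q by (simp add: algebra_simps)
  then have eq: "m p q - m p f - m (m p q) f = 0"
    by (simp add: diff_right assoc)
  have pq: "m p q = - p - q"
    using p by (simp add: algebra_simps eq_neg_iff_add_eq_0)
  have "- p - q - m p f + m p f + m q f = 0"
    using eq unfolding pq by (simp add: diff_left minus_left algebra_simps)
  then have "p = - (q - m q f)" by (simp add: algebra_simps)
  then have "p = - f" unfolding q .
  with p have "q = f + m f q"
    by (simp add: minus_left algebra_simps)
  then show ?thesis by blast
qed

text \<open>For \<open>a\<close> in the radical, all \<open>m t (m a s)\<close> are left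
  quasi-regular. If a modular maximal left ideal omitted \<open>m a s\<close>, one of them would be
  a right identity modulo it, which is impossible.\<close>

lemma two_sided_ideal_jacobson_radical: "two_sided_ideal m (jacobson_radical m)"
  unfolding two_sided_ideal_def
proof (intro conjI allI ballI left_ideal_jacobson_radical)
  fix s a assume a: "a \<in> jacobson_radical m"
  have qr: "\<exists>q. q - m q (m t (m a s)) = m t (m a s)" for t
  proof -
    have "m (m s t) a \<in> jacobson_radical m"
      using a left_ideal_jacobson_radical by (auto simp: left_ideal_def)
    then obtain q where q: "q - m q (m (m s t) a) = m (m s t) a"
      using left_quasi_regular by blast
    \<comment> \<open>Formally, the inverse of \<open>1 - u v\<close> is
      \<open>1 + u (1 + q) v\<close> when \<open>1 + q\<close> is the inverse of
      \<open>1 - v u\<close>; here \<open>u = m t a\<close> and \<open>v = s\<close>.\<close>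
    define p where "p = m (m t a) s + m (m t a) (m q s)"
    have "m t (m a (m s (m t (m a s)))) =
        m t (m a (m q s)) - m t (m a (m q (m s (m t (m a s)))))"
      using arg_cong[OF q, of "\<lambda>x. m (m (m t a) x) s"] by (simp add: diff_left diff_right assoc)
    then have "p - m p (m t (m a s)) = m t (m a s)"
      by (simp add: p_def distrib_right assoc)
    then show ?thesis by blast
  qed
  show "m a s \<in> jacobson_radical m"
    unfolding jacobson_radical_def
  proof (intro InterI, clarify)
    fix M assume M: "maximal_left_ideal m M" "modular_left_ideal m M"
    then obtain e where e: "\<And>x. m x e - x \<in> M" and LM: "left_ideal m M" "M \<noteq> UNIV"
      by (auto simp: modular_left_ideal_def maximal_left_ideal_def)
    have in_M: "x \<in> M" if "m x e \<in> M" for x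
    proof -
      have "m x e - (m x e - x) \<in> M"
        using that e[of x] LM(1) unfolding left_ideal_def by blast
      then show ?thesis by simp
    qed
    show "m a s \<in> M"
    proof (rule ccontr)
      assume notin: "m a s \<notin> M"
      \<comment> \<open>Without an identity the multiples \<open>m t (m a s)\<close> might all lie
        in \<open>M\<close>; the equality \<open>K = M\<close> excludes this.\<close>
      define K where "K = {x. \<forall>t. m t x \<in> M}"
      have "left_ideal m K"
        using LM by (auto simp: K_def left_ideal_def diff_right assoc[symmetric])
      moreover have "M \<subseteq> K"
        using LM by (auto simp: K_def left_ideal_def)
      moreover have "K \<noteq> UNIV"
        using LM(2) in_M by (auto simp: K_def)
      ultimately have "K = M"
        using M(1) by (auto simp: maximal_left_ideal_def)
      define I where "I = {y + m t (m a s) | y t. y \<in> M}"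
      have "left_ideal m I"
        unfolding left_ideal_def
      proof (intro conjI ballI allI)
        show "0 \<in> I"
          unfolding I_def using LM by (auto intro!: exI[of _ 0] simp: left_ideal_def)
        fix x y t assume "x \<in> I" "y \<in> I"
        then obtain x' y' tx ty where x: "x = x' + m tx (m a s)" "x' \<in> M"
          and y: "y = y' + m ty (m a s)" "y' \<in> M" by (auto simp: I_def)
        have "x - y = (x' - y') + m (tx - ty) (m a s)"
          by (simp add: x y diff_left)
        moreover have "x' - y' \<in> M" using x y LM by (auto simp: left_ideal_def)
        ultimately show "x - y \<in> I" unfolding I_def by blast
        have "m t x = m t x' + m (m t tx) (m a s)"
          by (simp add: x distrib_left assoc)
        moreover have "m t x' \<in> M" using x LM by (auto simp: left_ideal_def)
        ultimately show "m t x \<in> I" unfolding I_def by blast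
      qed
      moreover have "M \<subseteq> I"
      proof
        fix x assume "x \<in> M"
        moreover have "x = x + m 0 (m a s)" by simp
        ultimately show "x \<in> I" unfolding I_def by blast
      qed
      moreover have "I \<noteq> M"
      proof
        assume "I = M"
        have "0 + m t (m a s) \<in> I" for t
          unfolding I_def using LM(1) unfolding left_ideal_def by blast
        then have "m t (m a s) \<in> I" for t by simp
        with \<open>I = M\<close> \<open>K = M\<close> notin show False by (auto simp: K_def)
      qed
      ultimately have "I = UNIV"
        using M(1) by (auto simp: maximal_left_ideal_def)
      then obtain y t where y: "e = y + m t (m a s)" "y \<in> M"
        unfolding I_def by blast
      define b where "b = m t (m a s)"
      obtain q where q: "q - m q b = b"
        using qr unfolding b_def by blast
      have mod_b: "m x b - x \<in> M" for x
      proof -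
        have "m x b - x = (m x e - x) - m x y"
          by (simp add: y b_def distrib_left)
        moreover have "m x y \<in> M" using LM(1) y(2) unfolding left_ideal_def by blast
        ultimately show ?thesis using e[of x] LM(1) unfolding left_ideal_def by metis
      qed
      have "- (m q b - q) \<in> M"
        using mod_b left_ideal_uminus[OF LM(1)] by blast
      then have "b \<in> M" using q by simp
      then have "e \<in> M"
        using y left_ideal_add[OF LM(1)] by (simp add: b_def)
      then have "m x e \<in> M" for x
        using LM by (auto simp: left_ideal_def)
      then show False using in_M LM by blast
    qed
  qed
qed

end

section \<open>Ore extensions\<close>

text \<open>The polynomials \<open>\<Sum>i. x\<^sup>i p\<^sub>i\<close> with right coefficients \<open>p\<^sub>i\<close> in \<open>P\<close>, built by Horner's scheme.\<close>

inductive_set ore_span :: "('a::ring \<Rightarrow> 'a) \<Rightarrow> ('a \<Rightarrow> 'a) \<Rightarrow> 'a set \<Rightarrow> 'a poly set"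
  for \<sigma> D :: "'a \<Rightarrow> 'a" and P :: "'a set" where
  zero: "0 \<in> ore_span \<sigma> D P"
| step: "u \<in> ore_span \<sigma> D P \<Longrightarrow> p \<in> P \<Longrightarrow> ore_x \<sigma> D u + [:p:] \<in> ore_span \<sigma> D P"

context
  fixes \<sigma> D :: "'a::ring \<Rightarrow> 'a"
  assumes aut: "ring_automorphism \<sigma>" and der: "skew_derivation \<sigma> D"
begin

lemma ring_mult_ore: "ring_mult (ore_mult \<sigma> D)"
  by unfold_locales
    (simp_all add: ore_mult_assoc[OF aut der] ore_mult_distrib_left[OF aut der]
      ore_mult_distrib_right[OF aut der])

lemma sigma_pow_add: "(\<sigma> ^^ n) (a + b) = (\<sigma> ^^ n) a + (\<sigma> ^^ n) b"
  by (induction n) (auto simp: ore_maps[OF aut der])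

lemma sigma_pow_mult: "(\<sigma> ^^ n) (a * b) = (\<sigma> ^^ n) a * (\<sigma> ^^ n) b"
  by (induction n) (auto simp: ore_maps[OF aut der])

lemma sigma_pow_0: "(\<sigma> ^^ n) 0 = 0"
  by (induction n) (auto simp: ore_maps_0[OF aut der])

lemma sigma_pow_minus: "(\<sigma> ^^ n) (- a) = - (\<sigma> ^^ n) a"
  using sigma_pow_add[of n a "- a"] sigma_pow_0[of n] by (simp add: eq_neg_iff_add_eq_0 add.commute)

lemma sigma_pow_diff: "(\<sigma> ^^ n) (a - b) = (\<sigma> ^^ n) a - (\<sigma> ^^ n) b"
  using sigma_pow_add[of n a "- b"] by (simp add: sigma_pow_minus)

lemma sigma_pow_sum: "(\<sigma> ^^ n) (sum g A) = (\<Sum>i\<in>A. (\<sigma> ^^ n) (g i))"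
  by (induction A rule: infinite_finite_induct) (auto simp: sigma_pow_add sigma_pow_0)

lemma bij_sigma_pow: "bij (\<sigma> ^^ n)"
  using aut by (auto simp: ring_automorphism_def intro: bij_fn)

lemma ore_x_uminus: "ore_x \<sigma> D (- q) = - ore_x \<sigma> D q"
  using ore_x_add[OF aut der, of q "- q"] ore_x_0[OF aut der]
  by (simp add: eq_neg_iff_add_eq_0 add.commute)

lemma ore_x_pow_coeff:
  assumes "\<And>i. i > n \<Longrightarrow> coeff q i = 0"
  shows "(\<forall>i>n+k. coeff ((ore_x \<sigma> D ^^ k) q) i = 0) \<and>
    coeff ((ore_x \<sigma> D ^^ k) q) (n + k) = (\<sigma> ^^ k) (coeff q n)"
proof (induction k)
  case (Suc k)
  then show ?case
    by (auto simp: coeff_ore_x[OF aut der] ore_maps_0[OF aut der] split: nat.split)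
qed (use assms in auto)

text \<open>Formal degree bounds replace degrees, since a product of leading coefficients may be
  zero.\<close>

lemma ore_mult_coeff_top:
  assumes f: "\<And>i. i > m \<Longrightarrow> coeff f i = 0" and q: "\<And>i. i > n \<Longrightarrow> coeff q i = 0"
  shows "i > m + n \<Longrightarrow> coeff (ore_mult \<sigma> D f q) i = 0"
    and "coeff (ore_mult \<sigma> D f q) (m + n) = coeff f m * (\<sigma> ^^ m) (coeff q n)"
proof -
  have eq: "ore_mult \<sigma> D f q = (\<Sum>i\<le>m. map_poly ((*) (coeff f i)) ((ore_x \<sigma> D ^^ i) q))"
    by (rule ore_mult_altdef[OF aut der]) (use f in \<open>auto intro: degree_le\<close>)
  note X = ore_x_pow_coeff[of n q, OF q]
  show "i > m + n \<Longrightarrow> coeff (ore_mult \<sigma> D f q) i = 0"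
    unfolding eq by (auto simp: coeff_sum coeff_lmult[OF aut der] X intro!: sum.neutral)
  have "coeff (ore_mult \<sigma> D f q) (m + n) =
      (\<Sum>i\<le>m. coeff f i * coeff ((ore_x \<sigma> D ^^ i) q) (m + n))"
    unfolding eq by (simp add: coeff_sum coeff_lmult[OF aut der])
  also have "\<dots> = (\<Sum>i\<le>m. if i = m then coeff f m * coeff ((ore_x \<sigma> D ^^ m) q) (m + n) else 0)"
    by (rule sum.cong) (auto simp: X)
  also have "\<dots> = coeff f m * (\<sigma> ^^ m) (coeff q n)"
    using X by (simp add: add.commute)
  finally show "coeff (ore_mult \<sigma> D f q) (m + n) = coeff f m * (\<sigma> ^^ m) (coeff q n)" .
qed

section \<open>The degree filtration modulo a left ideal of the base ring\<close>

context
  fixes P :: "'a set"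
  assumes P: "left_ideal (*) P"
begin

lemma zero_in_P: "0 \<in> P"
  using P by (simp add: left_ideal_def)

lemma uminus_in_P: "a \<in> P \<Longrightarrow> - a \<in> P"
  using P unfolding left_ideal_def by (metis diff_0)

lemma add_in_P: "a \<in> P \<Longrightarrow> b \<in> P \<Longrightarrow> a + b \<in> P"
  using P uminus_in_P unfolding left_ideal_def by (metis diff_minus_eq_add)

lemma mult_in_P: "b \<in> P \<Longrightarrow> a * b \<in> P"
  using P unfolding left_ideal_def by blast

lemma ore_span_x: "u \<in> ore_span \<sigma> D P \<Longrightarrow> ore_x \<sigma> D u \<in> ore_span \<sigma> D P"
  using ore_span.step[of u \<sigma> D P 0] zero_in_P by simp

lemma ore_span_const: "p \<in> P \<Longrightarrow> [:p:] \<in> ore_span \<sigma> D P"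
  using ore_span.step[OF ore_span.zero, of p P \<sigma> D] by (simp add: ore_x_0[OF aut der])

lemma ore_span_add:
  "u \<in> ore_span \<sigma> D P \<Longrightarrow> u' \<in> ore_span \<sigma> D P \<Longrightarrow> u + u' \<in> ore_span \<sigma> D P"
proof (induction arbitrary: u' rule: ore_span.induct)
  case (step u p)
  from step.prems show ?case
  proof cases
    case (step w p')
    have "ore_x \<sigma> D (u + w) + [:p + p':] \<in> ore_span \<sigma> D P"
      using step \<open>p \<in> P\<close> by (intro ore_span.step step.IH add_in_P) auto
    moreover have "ore_x \<sigma> D (u + w) + [:p + p':] = ore_x \<sigma> D u + [:p:] + u'"
      using step by (simp add: ore_x_add[OF aut der])
    ultimately show ?thesis by simp
  qed (use step in \<open>auto intro: ore_span.step\<close>)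
qed auto

lemma ore_span_uminus: "u \<in> ore_span \<sigma> D P \<Longrightarrow> - u \<in> ore_span \<sigma> D P"
proof (induction rule: ore_span.induct)
  case (step u p)
  have "ore_x \<sigma> D (- u) + [:- p:] \<in> ore_span \<sigma> D P"
    using step by (intro ore_span.step uminus_in_P)
  then show ?case by (simp add: ore_x_uminus)
qed (auto intro: ore_span.zero)

lemma ore_span_diff:
  "u \<in> ore_span \<sigma> D P \<Longrightarrow> u' \<in> ore_span \<sigma> D P \<Longrightarrow> u - u' \<in> ore_span \<sigma> D P"
  using ore_span_add[of u "- u'"] ore_span_uminus[of u'] by simp

text \<open>By surjectivity \<open>r = \<sigma> s\<close>, and then \<open>r x = x s - D(s)\<close>
  moves the coefficient past \<open>x\<close>.\<close>

lemma ore_span_lmult: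
  "u \<in> ore_span \<sigma> D P \<Longrightarrow> map_poly ((*) r) u \<in> ore_span \<sigma> D P"
proof (induction arbitrary: r rule: ore_span.induct)
  case (step u p)
  obtain s where s: "r = \<sigma> s"
    using aut by (metis bij_pointE ring_automorphism_def)
  have "map_poly ((*) r) (ore_x \<sigma> D u) =
      ore_x \<sigma> D (map_poly ((*) s) u) - map_poly ((*) (D s)) u"
    by (simp add: s ore_x_lmult[OF aut der])
  moreover have "map_poly ((*) r) [:p:] = [:r * p:]"
    by (rule poly_eqI) (simp add: coeff_lmult[OF aut der] coeff_pCons split: nat.split)
  ultimately show ?case
    using step by (auto simp: lmult_add[OF aut der] intro!: ore_span_add ore_span_diff ore_span_x
        ore_span_const mult_in_P)
qed (auto intro: ore_span.zero)

lemma ore_span_mult: "u \<in> ore_span \<sigma> D P \<Longrightarrow> ore_mult \<sigma> D f u \<in> ore_span \<sigma> D P"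
proof -
  assume u: "u \<in> ore_span \<sigma> D P"
  have "(ore_x \<sigma> D ^^ i) u \<in> ore_span \<sigma> D P" for i
    by (induction i) (auto simp: u ore_span_x)
  then have "map_poly ((*) (coeff f i)) ((ore_x \<sigma> D ^^ i) u) \<in> ore_span \<sigma> D P" for i
    by (rule ore_span_lmult)
  moreover have "sum g A \<in> ore_span \<sigma> D P" if "\<And>i. g i \<in> ore_span \<sigma> D P" for g :: "nat \<Rightarrow> _" and A
    by (induction A rule: infinite_finite_induct) (auto intro: ore_span.zero ore_span_add that)
  ultimately show ?thesis
    by (simp add: ore_mult_def)
qed

text \<open>The leading left coefficient of \<open>x^n p\<close> is
  \<open>(\<sigma> ^^ n) p\<close>. As \<open>\<sigma>\<close> is injective, a Horner step raises
  the degree of a nonzero polynomial, so the bound for \<open>u\<close> is one less.\<close>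

lemma ore_span_top_coeff:
  "u \<in> ore_span \<sigma> D P \<Longrightarrow> (\<And>i. i > n \<Longrightarrow> coeff u i = 0) \<Longrightarrow> coeff u n \<in> (\<sigma> ^^ n) ` P"
proof (induction arbitrary: n rule: ore_span.induct)
  case zero
  then show ?case using sigma_pow_0[of n] zero_in_P by (auto intro!: image_eqI[of _ _ 0])
next
  case (step u p)
  have \<sigma>_eq_0: "\<sigma> a = 0 \<Longrightarrow> a = 0" for a
    using aut ore_maps_0[OF aut der] unfolding ring_automorphism_def bij_def by (metis injD)
  have deg: "degree u < n" if "u \<noteq> 0"
  proof (rule ccontr)
    assume "\<not> degree u < n"
    then have "coeff (ore_x \<sigma> D u + [:p:]) (Suc (degree u)) = 0"
      using step.prems[of "Suc (degree u)"] by simp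
    then have "\<sigma> (coeff u (degree u)) = 0"
      by (simp add: coeff_ore_x[OF aut der] coeff_eq_0 ore_maps_0[OF aut der])
    then have "lead_coeff u = 0" by (rule \<sigma>_eq_0)
    then show False using that by simp
  qed
  show ?case
  proof (cases n)
    case 0
    then have "u = 0" using deg by auto
    then show ?thesis using 0 step by (simp add: ore_x_0[OF aut der])
  next
    case (Suc k)
    have zero: "coeff u i = 0" if "i > k" for i
      using deg that Suc by (cases "u = 0") (auto intro: coeff_eq_0)
    then have "coeff u k \<in> (\<sigma> ^^ k) ` P"
      by (rule step.IH)
    then show ?thesis
      using Suc zero by (auto simp: coeff_ore_x[OF aut der] ore_maps_0[OF aut der])
  qed
qed

text \<open>As long as the leading coefficient is \<open>(\<sigma> ^^ n) r\<close> with
  \<open>r\<close> in \<open>P\<close>, the polynomial \<open>x^n r\<close> is subtracted.\<close>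

lemma ore_span_cases:
  assumes "\<And>i. i \<ge> n \<Longrightarrow> coeff u i = 0" and "u \<notin> ore_span \<sigma> D P"
  shows "\<exists>k u' r. u - u' \<in> ore_span \<sigma> D P \<and> (\<forall>i>k. coeff u' i = 0) \<and>
    coeff u' k = (\<sigma> ^^ k) r \<and> r \<notin> P"
  using assms
proof (induction n arbitrary: u)
  case 0
  then have "u = 0" by (auto intro: poly_eqI)
  then show ?case using 0(2) ore_span.zero[of \<sigma> D P] by simp
next
  case (Suc n)
  obtain r where r: "coeff u n = (\<sigma> ^^ n) r"
    using bij_sigma_pow by (metis bij_pointE)
  show ?case
  proof (cases "r \<in> P")
    case False
    then show ?thesis
      using r Suc.prems by (intro exI[of _ n] exI[of _ u] exI[of _ r]) (auto intro: ore_span.zero)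
  next
    case True
    define b where "b = (ore_x \<sigma> D ^^ n) [:r:]"
    have b: "b \<in> ore_span \<sigma> D P"
      unfolding b_def by (induction n) (auto simp: True ore_span_const ore_span_x)
    have "(\<forall>i>0+n. coeff b i = 0) \<and> coeff b (0 + n) = (\<sigma> ^^ n) (coeff [:r:] 0)"
      unfolding b_def by (rule ore_x_pow_coeff) (auto simp: coeff_pCons split: nat.split)
    then have "coeff (u - b) i = 0" if "i \<ge> n" for i
      using that r Suc.prems(1) by (cases "i = n") auto
    moreover have "u - b \<notin> ore_span \<sigma> D P"
      using ore_span_add[OF _ b, of "u - b"] Suc.prems(2) by auto
    ultimately obtain k u' s where k: "u - b - u' \<in> ore_span \<sigma> D P" "\<forall>i>k. coeff u' i = 0"
      "coeff u' k = (\<sigma> ^^ k) s" "s \<notin> P"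
      using Suc.IH by blast
    have "u - u' \<in> ore_span \<sigma> D P"
      using ore_span_add[OF k(1) b] by (simp add: algebra_simps)
    with k show ?thesis by blast
  qed
qed

text \<open>
  Modulo \<open>ore_span \<sigma> D P\<close>, left multiplication by \<open>f\<close> raises the degree of every element with
  right coefficients in the quotient of the ring by \<open>P\<close>, so \<open>u = c + f u\<close> has no solution \<open>u\<close>.
\<close>

lemma jacobson_radical_top_coeff:
  assumes f: "f \<in> jacobson_radical (ore_mult \<sigma> D)"
    and deg: "\<And>i. i > m \<Longrightarrow> coeff f i = 0" and m: "m > 0"
    and inj: "\<And>N r. coeff f m * (\<sigma> ^^ N) r \<in> (\<sigma> ^^ N) ` P \<Longrightarrow> r \<in> P"
  shows "P = UNIV"
proof (rule ccontr)
  assume "P \<noteq> UNIV"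
  then obtain c where c: "c \<notin> P" by blast
  interpret ring_mult "ore_mult \<sigma> D" by (rule ring_mult_ore)
  define M where "M = ore_mult \<sigma> D"
  obtain q where q: "q = f + M f q"
    using quasi_inverse[OF f] M_def by blast
  \<comment> \<open>Formally this is the inverse of \<open>1 - f\<close> applied to
    \<open>c\<close>.\<close>
  define u where "u = [:c:] + M q [:c:]"
  have "M f u = M (f + M f q) [:c:]"
    by (simp add: u_def M_def distrib_left distrib_right assoc)
  then have u: "M f u = u - [:c:]"
    using q by (simp add: u_def)
  show False
  proof (cases "u \<in> ore_span \<sigma> D P")
    case True
    then have "u - M f u \<in> ore_span \<sigma> D P"
      unfolding M_def by (intro ore_span_diff ore_span_mult)
    then have "[:c:] \<in> ore_span \<sigma> D P" using u by simp
    then have "coeff [:c:] 0 \<in> (\<sigma> ^^ 0) ` P"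
      by (rule ore_span_top_coeff) (auto simp: coeff_pCons split: nat.split)
    then show False using c by simp
  next
    case False
    have "coeff u i = 0" if "i \<ge> Suc (degree u)" for i
      using that by (auto intro: coeff_eq_0)
    with False obtain n u' r where n: "u - u' \<in> ore_span \<sigma> D P" "\<And>i. i > n \<Longrightarrow> coeff u' i = 0"
      "coeff u' n = (\<sigma> ^^ n) r" "r \<notin> P"
      using ore_span_cases by blast
    \<comment> \<open>As \<open>m > 0\<close>, the coefficient of \<open>b\<close> in degree
      \<open>m + n\<close> comes from \<open>M f u'\<close> alone.\<close>
    define b where "b = M f u' - u' + [:c:]"
    have "b = (u - u') - M f (u - u')"
      using u by (simp add: b_def M_def diff_right algebra_simps)
    then have "b \<in> ore_span \<sigma> D P"
      using n(1) unfolding M_def by (auto intro!: ore_span_diff ore_span_mult)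
    note top = ore_mult_coeff_top[of m f n u', OF deg n(2)]
    have "coeff b i = 0" if "i > m + n" for i
      using that top(1)[of i] n(2) by (auto simp: b_def M_def coeff_pCons split: nat.split)
    with \<open>b \<in> _\<close> have "coeff b (m + n) \<in> (\<sigma> ^^ (m + n)) ` P"
      by (rule ore_span_top_coeff)
    moreover have "coeff b (m + n) = coeff f m * (\<sigma> ^^ (m + n)) r"
      using top(2) n(2,3) m by (auto simp: b_def M_def coeff_pCons funpow_add split: nat.split)
    ultimately show False using inj n(4) by auto
  qed
qed

end

end

section \<open>Prime ideals and orbits\<close>

lemma funpow_times: "((*) (a::'a::ring) ^^ i) b * c = ((*) a ^^ i) (b * c)"
  by (induction i) (auto simp: mult.assoc)

text \<open>An ideal \<open>P\<close> maximal among those without powers of \<open>a\<close> is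
  prime: if all \<open>b * r * c\<close> lie in \<open>P\<close> with \<open>b\<close> and
  \<open>c\<close> outside, the larger ideals \<open>B\<close> and then \<open>C\<close> allow
  \<open>b\<close> and \<open>c\<close> to be replaced by powers of \<open>a\<close>.\<close>

lemma exists_prime_avoiding:
  fixes a :: "'a::ring"
  assumes a: "\<not> nilpotent_element a"
  shows "\<exists>P. prime_ideal P \<and> a \<notin> P"
proof -
  define pw where "pw n = ((*) a ^^ n) a" for n
  have pw: "pw i * a * pw j = pw (i + Suc (Suc j))" for i j
    unfolding pw_def funpow_times funpow_add o_apply by (simp add: mult.assoc)
  have tsi: "two_sided_ideal (*) I \<longleftrightarrow> 0 \<in> I \<and> (\<forall>x\<in>I. \<forall>y\<in>I. x - y \<in> I) \<and>
      (\<forall>s. \<forall>x\<in>I. s * x \<in> I) \<and> (\<forall>s. \<forall>x\<in>I. x * s \<in> I)" for I :: "'a set"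
    by (auto simp: two_sided_ideal_def left_ideal_def)
  define \<A> where "\<A> = {I. two_sided_ideal (*) I \<and> (\<forall>n. pw n \<notin> I)}"
  have "\<exists>M\<in>\<A>. \<forall>I\<in>\<A>. M \<subseteq> I \<longrightarrow> I = M"
  proof (rule subset_Zorn_nonempty)
    have "{0} \<in> \<A>"
      using a by (auto simp: \<A>_def tsi pw_def nilpotent_element_def)
    then show "\<A> \<noteq> {}" by blast
    fix \<C> assume C: "\<C> \<noteq> {}" "subset.chain \<A> \<C>"
    then have sub: "\<And>I. I \<in> \<C> \<Longrightarrow> two_sided_ideal (*) I \<and> (\<forall>n. pw n \<notin> I)"
      by (auto simp: subset.chain_def \<A>_def)
    have ideal: "two_sided_ideal (*) H" if "H \<in> \<C>" for H
      using sub that by blast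
    have "x - y \<in> \<Union>\<C>" if "x \<in> \<Union>\<C>" "y \<in> \<Union>\<C>" for x y
    proof -
      from that obtain I K where IK: "I \<in> \<C>" "x \<in> I" "K \<in> \<C>" "y \<in> K" by blast
      have "I \<subseteq> K \<or> K \<subseteq> I"
        using C(2) IK by (auto simp: subset.chain_def)
      with IK obtain H where H: "H \<in> \<C>" "x \<in> H" "y \<in> H" by blast
      then have "x - y \<in> H" using ideal[OF H(1)] by (simp add: tsi)
      with H(1) show ?thesis by blast
    qed
    moreover have "0 \<in> \<Union>\<C>"
    proof -
      obtain H where H: "H \<in> \<C>" using C(1) by blast
      then have "0 \<in> H" using ideal[OF H] by (simp add: tsi)
      with H show ?thesis by blast
    qed
    moreover have "s * x \<in> \<Union>\<C>" "x * s \<in> \<Union>\<C>" if "x \<in> \<Union>\<C>" for s x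
    proof -
      from that obtain H where H: "H \<in> \<C>" "x \<in> H" by blast
      then have "s * x \<in> H" "x * s \<in> H" using ideal[OF H(1)] by (simp_all add: tsi)
      with H(1) show "s * x \<in> \<Union>\<C>" "x * s \<in> \<Union>\<C>" by blast+
    qed
    ultimately have "two_sided_ideal (*) (\<Union>\<C>)"
      by (simp only: tsi) blast
    then show "\<Union>\<C> \<in> \<A>" using sub by (auto simp: \<A>_def)
  qed
  then obtain P where P: "two_sided_ideal (*) P" "\<And>n. pw n \<notin> P"
    and max: "\<And>I. I \<in> \<A> \<Longrightarrow> P \<subseteq> I \<Longrightarrow> I = P"
    by (auto simp: \<A>_def)
  have prime: "b \<in> P \<or> c \<in> P" if bc: "\<And>r. b * r * c \<in> P" for b c
  proof (rule ccontr)
    assume neither: "\<not> ?thesis"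
    have power: "\<exists>i. pw i \<in> I" if "two_sided_ideal (*) I" "P \<subseteq> I" "e \<in> I" "e \<notin> P" for I e
      using max[of I] that by (auto simp: \<A>_def)
    define B where "B = {x. \<forall>r. x * r * c \<in> P}"
    have P': "0 \<in> P" "\<And>x y. x \<in> P \<Longrightarrow> y \<in> P \<Longrightarrow> x - y \<in> P" "\<And>s x. x \<in> P \<Longrightarrow> s * x \<in> P"
      "\<And>s x. x \<in> P \<Longrightarrow> x * s \<in> P"
      using P(1) by (simp_all add: tsi)
    have "two_sided_ideal (*) B"
      unfolding tsi
    proof (intro conjI ballI allI)
      show "0 \<in> B" using P'(1) by (simp add: B_def)
      fix x y s assume x: "x \<in> B" and y: "y \<in> B"
      show "x - y \<in> B" using x y P'(2) by (simp add: B_def left_diff_distrib)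
      have "s * (x * r * c) \<in> P" "x * (s * r) * c \<in> P" for r
        using x P'(3) by (simp_all add: B_def)
      then show "s * x \<in> B" "x * s \<in> B" by (simp_all add: B_def mult.assoc)
    qed
    moreover have "P \<subseteq> B" using P'(4) by (auto simp: B_def)
    moreover have "b \<in> B" using bc by (simp add: B_def)
    ultimately obtain i where i: "pw i \<in> B" using power neither by blast
    define C where "C = {y. \<forall>r. pw i * r * y \<in> P}"
    have "two_sided_ideal (*) C"
      unfolding tsi
    proof (intro conjI ballI allI)
      show "0 \<in> C" using P'(1) by (simp add: C_def)
      fix x y s assume x: "x \<in> C" and y: "y \<in> C"
      show "x - y \<in> C" using x y P'(2) by (simp add: C_def right_diff_distrib)
      have "pw i * (r * s) * x \<in> P" "pw i * r * x * s \<in> P" for r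
        using x P'(4) by (simp_all add: C_def)
      then show "s * x \<in> C" "x * s \<in> C" by (simp_all add: C_def mult.assoc)
    qed
    moreover have "P \<subseteq> C" using P'(3) by (auto simp: C_def)
    moreover have "c \<in> C" using i by (simp add: B_def C_def)
    ultimately obtain j where "pw j \<in> C" using power neither by blast
    then have "pw i * a * pw j \<in> P" by (simp add: C_def)
    then show False using P(2) by (simp add: pw)
  qed
  have "a \<notin> P" using P(2)[of 0] by (simp add: pw_def)
  moreover have "prime_ideal P"
    using P(1) prime \<open>a \<notin> P\<close> by unfold_locales auto
  ultimately show ?thesis by blast
qed

context
  fixes \<sigma> D :: "'a::ring \<Rightarrow> 'a"
  assumes aut: "ring_automorphism \<sigma>" and der: "skew_derivation \<sigma> D"
begin

lemma two_sided_ideal_constants: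
  "two_sided_ideal (*) {a. [:a:] \<in> jacobson_radical (ore_mult \<sigma> D)}"
proof -
  interpret ring_mult "ore_mult \<sigma> D" by (rule ring_mult_ore[OF aut der])
  have "[:a - b:] = [:a:] - [:b:]" for a b :: 'a by simp
  then show ?thesis
    using two_sided_ideal_jacobson_radical
    unfolding two_sided_ideal_def left_ideal_def
    by (simp add: ore_mult_const[OF aut der, symmetric] del: diff_pCons)
qed

lemma prime_ideal_preimage:
  assumes "prime_ideal P"
  shows "prime_ideal {a. (\<sigma> ^^ i) a \<in> P}"
proof -
  interpret prime_ideal P by fact
  have surj: "\<exists>a. b = (\<sigma> ^^ i) a" for b
    using bij_sigma_pow[OF aut der, of i] by (metis bij_pointE)
  show ?thesis
  proof
    show "two_sided_ideal (*) {a. (\<sigma> ^^ i) a \<in> P}"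
      unfolding two_sided_ideal_def left_ideal_def
      by (simp add: sigma_pow_0[OF aut der] sigma_pow_diff[OF aut der] sigma_pow_mult[OF aut der]
          diff multl multr)
    obtain b where "b \<notin> P" using proper by blast
    moreover obtain a where "b = (\<sigma> ^^ i) a" using surj by blast
    ultimately have "a \<notin> {a. (\<sigma> ^^ i) a \<in> P}" by simp
    then show "{a. (\<sigma> ^^ i) a \<in> P} \<noteq> UNIV" by blast
    fix a b assume *: "\<And>r. a * r * b \<in> {a. (\<sigma> ^^ i) a \<in> P}"
    have "(\<sigma> ^^ i) a * r * (\<sigma> ^^ i) b \<in> P" for r
    proof -
      obtain s where "r = (\<sigma> ^^ i) s" using surj by blast
      then show ?thesis using *[of s] by (simp add: sigma_pow_mult[OF aut der])
    qed
    then show "a \<in> {a. (\<sigma> ^^ i) a \<in> P} \<or> b \<in> {a. (\<sigma> ^^ i) a \<in> P}"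
      using prime by blast
  qed
qed

lemma sigma_pow_cap:
  "(\<sigma> ^^ k) (cap n x y) = cap n (\<lambda>i. (\<sigma> ^^ k) (x i)) (\<lambda>i. (\<sigma> ^^ k) (y i))"
proof (induction n arbitrary: x)
  case (Suc n)
  have "(\<lambda>j. (\<sigma> ^^ k) ((x(i := x n)) j)) = (\<lambda>j. (\<sigma> ^^ k) (x j))(i := (\<sigma> ^^ k) (x n))" for i
    by auto
  then show ?case
    by (simp only: cap.simps sigma_pow_diff[OF aut der] sigma_pow_mult[OF aut der]
        sigma_pow_sum[OF aut der] Suc.IH)
qed simp

text \<open>The cube at \<open>Max A\<close> comes from raising the degree to \<open>n\<close>
  inside the radical, as in \<open>orbit_prod_top_coeff\<close>.\<close>

definition orbit_prod :: "'a \<Rightarrow> nat \<Rightarrow> nat set \<Rightarrow> 'a" where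
  "orbit_prod z k A = foldr (\<lambda>l b. (\<sigma> ^^ (k + l)) z * b) (sorted_list_of_set A)
     ((\<sigma> ^^ (k + Max A)) z * (\<sigma> ^^ (k + Max A)) z * (\<sigma> ^^ (k + Max A)) z)"

lemma sigma_pow_orbit_prod: "(\<sigma> ^^ k) (orbit_prod z 0 A) = orbit_prod z k A"
proof -
  have "(\<sigma> ^^ k) (foldr (\<lambda>l b. (\<sigma> ^^ (0 + l)) z * b) ls c) =
      foldr (\<lambda>l b. (\<sigma> ^^ (k + l)) z * b) ls ((\<sigma> ^^ k) c)" for ls c
    by (induction ls) (simp_all add: sigma_pow_mult[OF aut der] funpow_add)
  then show ?thesis
    by (simp add: orbit_prod_def sigma_pow_mult[OF aut der] funpow_add)
qed

text \<open>With \<open>s = (\<sigma> ^^ i) z\<close>, the product of \<open>s x^i\<close>,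
  \<open>z\<close> and \<open>z x^(n - i)\<close> has \<open>s * s * s\<close> as coefficient of
  \<open>x^n\<close>. The remaining factors are multiplied on from the left as constants.\<close>

lemma orbit_prod_top_coeff:
  assumes z: "[:z:] \<in> jacobson_radical (ore_mult \<sigma> D)" and A: "A \<subseteq> {..<n}" "A \<noteq> {}"
  shows "\<exists>f\<in>jacobson_radical (ore_mult \<sigma> D). (\<forall>i>n. coeff f i = 0) \<and> coeff f n = orbit_prod z 0 A"
proof -
  interpret ring_mult "ore_mult \<sigma> D" by (rule ring_mult_ore[OF aut der])
  define M where "M = ore_mult \<sigma> D"
  define J where "J = jacobson_radical M"
  have J: "M s f \<in> J" "M f s \<in> J" if "f \<in> J" for f s
    using two_sided_ideal_jacobson_radical that
    by (auto simp: two_sided_ideal_def left_ideal_def J_def M_def)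
  note top = ore_mult_coeff_top[OF aut der, folded M_def]
  define i where "i = Max A"
  have "i < n" using A Max_in[of A] finite_subset[OF A(1)] by (auto simp: i_def)
  define s where "s = (\<sigma> ^^ i) z"
  define g where "g = M (monom s i) [:z:]"
  have g: "\<And>j. j > i \<Longrightarrow> coeff g j = 0" "coeff g i = s * s"
    using top[of i "monom s i" 0 "[:z:]"] by (auto simp: g_def s_def coeff_pCons split: nat.split)
  define h where "h = M g (monom z (n - i))"
  have h: "\<And>j. j > n \<Longrightarrow> coeff h j = 0" "coeff h n = s * s * s"
    using top[of i g "n - i" "monom z (n - i)"] g \<open>i < n\<close> by (auto simp: h_def s_def)
  have "h \<in> J" using z unfolding h_def g_def by (intro J) (simp add: J_def M_def)
  have "\<exists>f\<in>J. (\<forall>j>n. coeff f j = 0) \<and>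
      coeff f n = foldr (\<lambda>l b. (\<sigma> ^^ (0 + l)) z * b) ls (s * s * s)" for ls
  proof (induction ls)
    case Nil
    then show ?case using h \<open>h \<in> J\<close> by auto
  next
    case (Cons l ls)
    then obtain f where f: "f \<in> J" "\<And>j. j > n \<Longrightarrow> coeff f j = 0"
      "coeff f n = foldr (\<lambda>l b. (\<sigma> ^^ (0 + l)) z * b) ls (s * s * s)" by blast
    show ?case
      using J(1)[OF f(1), of "[:(\<sigma> ^^ l) z:]"] top[of 0 "[:(\<sigma> ^^ l) z:]" n f] f(2,3)
      by (intro bexI[of _ "M [:(\<sigma> ^^ l) z:] f"]) (auto simp: coeff_pCons split: nat.split)
  qed
  from this[of "sorted_list_of_set A"] show ?thesis
    by (simp add: orbit_prod_def i_def[symmetric] s_def J_def M_def)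
qed

text \<open>
  The set \<open>T\<close> describes which members of the orbit of \<open>z\<close> survive modulo \<open>P\<close>. Up to repetition of
  factors, \<open>w\<close> is the elementary symmetric function of degree \<open>card T\<close> of the orbit, and modulo
  \<open>P\<close> exactly one of the summands of each \<open>(\<sigma> ^^ k) w\<close> survives.
\<close>

lemma orbit_central_imp_in_prime:
  assumes P: "prime_ideal P" and z: "[:z:] \<in> jacobson_radical (ore_mult \<sigma> D)"
    and n: "n > 0" "(\<sigma> ^^ n) z = z"
    and central: "\<And>i. (\<sigma> ^^ i) z \<in> P \<or> (\<forall>w. (\<sigma> ^^ i) z * w - w * (\<sigma> ^^ i) z \<in> P)"
  shows "z \<in> P"
proof (rule ccontr)
  assume zP: "z \<notin> P"
  interpret prime_ideal P by fact
  interpret R: ring_mult "ore_mult \<sigma> D" by (rule ring_mult_ore[OF aut der])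
  define Z where "Z i = (\<sigma> ^^ i) z" for i
  have period: "Z (n * k + i) = Z i" for k i
  proof (induction k)
    case (Suc k)
    have "Z (n * Suc k + i) = (\<sigma> ^^ (n * k + i)) ((\<sigma> ^^ n) z)"
      unfolding Z_def funpow_add[unfolded o_def, symmetric, THEN fun_cong]
      by (simp add: funpow_add[symmetric, unfolded o_def, THEN fun_cong] add_ac)
    then show ?case using Suc n(2) by (simp add: Z_def)
  qed simp
  have Z_mod: "Z (i mod n) = Z i" for i
    using period[of "i div n" "i mod n"] by simp
  have regular: "r \<in> P" if "Z i \<notin> P" "Z i * r \<in> P" for i r
  proof (rule prime'[OF that(1)])
    fix s
    have "(Z i * s - s * Z i) * r \<in> P"
      using central[of i] that(1) by (auto simp: Z_def intro: multr)
    moreover have "s * (Z i * r) \<in> P" using that(2) by (rule multl)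
    ultimately have "(Z i * s - s * Z i) * r + s * (Z i * r) \<in> P" by (rule add)
    then show "Z i * s * r \<in> P" by (simp add: left_diff_distrib mult.assoc)
  qed
  define T where "T = {i. i < n \<and> Z i \<notin> P}"
  have T0: "0 \<in> T" using n zP by (simp add: T_def Z_def)
  have finT: "finite T" by (simp add: T_def)
  define \<D> where "\<D> = {A. A \<subseteq> {..<n} \<and> card A = card T}"
  have fin\<D>: "finite \<D>"
    by (rule finite_subset[of _ "Pow {..<n}"]) (auto simp: \<D>_def)
  have ne: "A \<noteq> {}" "finite A" if "A \<in> \<D>" for A
    using that T0 finT finite_subset[of A "{..<n}"] by (auto simp: \<D>_def)
  define w where "w = (\<Sum>A\<in>\<D>. orbit_prod z 0 A)"
  have \<sigma>w: "(\<sigma> ^^ k) w = (\<Sum>A\<in>\<D>. orbit_prod z k A)" for k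
    by (simp add: w_def sigma_pow_sum[OF aut der] sigma_pow_orbit_prod)
  have orbit_prod_in_P: "orbit_prod z k A \<in> P" if "l \<in> A" "finite A" "Z (k + l) \<in> P" for k l A
  proof -
    have "foldr (\<lambda>l b. (\<sigma> ^^ (k + l)) z * b) ls c \<in> P" if "l \<in> set ls" for ls c
      using that \<open>Z (k + l) \<in> P\<close> by (induction ls) (auto simp: Z_def intro: multl multr)
    then show ?thesis using that by (simp add: orbit_prod_def)
  qed
  have orbit_prod_regular: "r \<in> P"
    if A: "A \<noteq> {}" "finite A" "\<And>l. l \<in> A \<Longrightarrow> Z (k + l) \<notin> P" and r: "orbit_prod z k A * r \<in> P"
    for k A r
  proof -
    have "c * r \<in> P" if "set ls \<subseteq> A" "foldr (\<lambda>l b. (\<sigma> ^^ (k + l)) z * b) ls c * r \<in> P" for ls c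
      using that
    proof (induction ls)
      case (Cons l ls)
      have l: "l \<in> A" "set ls \<subseteq> A" using Cons.prems(1) by auto
      have "Z (k + l) * (foldr (\<lambda>l b. (\<sigma> ^^ (k + l)) z * b) ls c * r) \<in> P"
        using Cons.prems(2) by (simp add: Z_def mult.assoc)
      then have "foldr (\<lambda>l b. (\<sigma> ^^ (k + l)) z * b) ls c * r \<in> P"
        by (rule regular[OF A(3)[OF l(1)]])
      with l(2) show ?case by (rule Cons.IH)
    qed simp
    from this[OF _ r[unfolded orbit_prod_def]] A(2)
    have *: "Z (k + Max A) * (Z (k + Max A) * (Z (k + Max A) * r)) \<in> P"
      by (simp add: Z_def mult.assoc)
    have notin: "Z (k + Max A) \<notin> P" using A(1,2) by (intro A(3) Max_in)
    show ?thesis by (rule regular[OF notin regular[OF notin regular[OF notin *]]])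
  qed
  have w_regular: "r \<in> P" if r: "(\<sigma> ^^ k) w * r \<in> P" for k r
  proof -
    \<comment> \<open>The rotation \<open>f\<close> by \<open>k\<close> maps \<open>A\<close>
      bijectively onto \<open>T\<close>, so \<open>A\<close> belongs to \<open>\<D>\<close> and
      indexes the surviving summand of \<open>(\<sigma> ^^ k) w\<close>.\<close>
    define A where "A = {i. i < n \<and> Z (k + i) \<notin> P}"
    define f where "f i = (k + i) mod n" for i
    have inj_le: "i = j" if "i \<le> j" "j < n" "f i = f j" for i j
    proof -
      have "n dvd (k + j) - (k + i)"
        using that mod_eq_dvd_iff_nat[of "k + i" "k + j" n] by (simp add: f_def)
      then have "\<not> 0 < j - i"
        using less_imp_diff_less[OF that(2), of i] nat_dvd_not_less[of "j - i" n] by auto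
      with that(1) show ?thesis by simp
    qed
    have inj: "inj_on f {..<n}"
    proof (rule inj_onI)
      fix i j assume "i \<in> {..<n}" "j \<in> {..<n}" "f i = f j"
      then show "i = j" using inj_le[of i j] inj_le[of j i] by (cases "i \<le> j") auto
    qed
    have "f ` {..<n} \<subseteq> {..<n}" using n(1) by (auto simp: f_def)
    then have surj: "f ` {..<n} = {..<n}"
      using inj by (intro endo_inj_surj) auto
    have fA: "f i \<in> T \<longleftrightarrow> i \<in> A" if "i < n" for i
      using that n(1) by (simp add: f_def T_def A_def Z_mod)
    have "f ` A = T"
    proof
      show "f ` A \<subseteq> T" using fA by (auto simp: A_def)
      show "T \<subseteq> f ` A"
      proof
        fix j assume j: "j \<in> T"
        then have "j \<in> f ` {..<n}" unfolding surj by (simp add: T_def)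
        with j fA show "j \<in> f ` A" by auto
      qed
    qed
    moreover have "inj_on f A" using inj by (rule inj_on_subset) (auto simp: A_def)
    ultimately have A: "A \<in> \<D>"
      using card_image[of f A] by (auto simp: \<D>_def A_def)
    have "orbit_prod z k B \<in> P" if "B \<in> \<D> - {A}" for B
    proof -
      \<comment> \<open>All sets in \<open>\<D>\<close> have the same size, so a set other than
        \<open>A\<close> contains an index whose factor lies in \<open>P\<close>.\<close>
      have "\<not> B \<subseteq> A"
        using card_subset_eq[of A B] that A ne(2)[OF A] by (auto simp: \<D>_def)
      then obtain l where "l \<in> B" "l \<notin> A" by blast
      then have "Z (k + l) \<in> P" using that by (auto simp: A_def \<D>_def)
      then show ?thesis using orbit_prod_in_P \<open>l \<in> B\<close> ne(2) that by blast
    qed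
    then have "(\<Sum>B\<in>\<D> - {A}. orbit_prod z k B) * r \<in> P"
      by (intro multr sum)
    moreover have "(\<sigma> ^^ k) w * r - (\<Sum>B\<in>\<D> - {A}. orbit_prod z k B) * r = orbit_prod z k A * r"
      unfolding \<sigma>w sum.remove[OF fin\<D> A] by (simp add: distrib_right)
    ultimately have "orbit_prod z k A * r \<in> P"
      using diff[OF r] by metis
    moreover have "\<And>l. l \<in> A \<Longrightarrow> Z (k + l) \<notin> P" by (simp add: A_def)
    ultimately show ?thesis
      using orbit_prod_regular[OF ne[OF A]] by blast
  qed
  have \<sigma>w_period: "(\<sigma> ^^ (n * k)) w = w" for k
  proof -
    have "orbit_prod z (n * k) A = orbit_prod z 0 A" for A
      using period[of k] by (simp add: orbit_prod_def Z_def)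
    then show ?thesis unfolding \<sigma>w by (simp add: w_def)
  qed
  have "\<forall>A\<in>\<D>. \<exists>f. f \<in> jacobson_radical (ore_mult \<sigma> D) \<and> (\<forall>i>n. coeff f i = 0) \<and>
      coeff f n = orbit_prod z 0 A"
  proof
    fix A assume A: "A \<in> \<D>"
    then have "A \<subseteq> {..<n}" by (simp add: \<D>_def)
    from orbit_prod_top_coeff[OF z this ne(1)[OF A]] show "\<exists>f. f \<in> jacobson_radical (ore_mult \<sigma> D) \<and>
        (\<forall>i>n. coeff f i = 0) \<and> coeff f n = orbit_prod z 0 A"
      by blast
  qed
  from bchoice[OF this] obtain F where F: "\<And>A. A \<in> \<D> \<Longrightarrow> F A \<in> jacobson_radical (ore_mult \<sigma> D)"
    "\<And>A i. A \<in> \<D> \<Longrightarrow> i > n \<Longrightarrow> coeff (F A) i = 0"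
    "\<And>A. A \<in> \<D> \<Longrightarrow> coeff (F A) n = orbit_prod z 0 A"
    by blast
  have sumJ: "(\<And>A. A \<in> \<B> \<Longrightarrow> F A \<in> jacobson_radical (ore_mult \<sigma> D)) \<Longrightarrow>
      sum F \<B> \<in> jacobson_radical (ore_mult \<sigma> D)" for \<B>
    by (induction \<B> rule: infinite_finite_induct)
      (auto intro: R.left_ideal_add[OF R.left_ideal_jacobson_radical]
        simp: R.left_ideal_jacobson_radical[unfolded left_ideal_def])
  have "P = UNIV"
  proof (rule jacobson_radical_top_coeff[OF aut der left_ideal, of "sum F \<D>" n])
    show "sum F \<D> \<in> jacobson_radical (ore_mult \<sigma> D)"
      by (rule sumJ) (rule F(1))
    show "coeff (sum F \<D>) i = 0" if "i > n" for i
      using F(2) that by (simp add: coeff_sum)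
    show "n > 0" by fact
    fix N r assume *: "coeff (sum F \<D>) n * (\<sigma> ^^ N) r \<in> (\<sigma> ^^ N) ` P"
    \<comment> \<open>\<open>N + k\<close> is a multiple of the period \<open>n\<close>, so
      \<open>w\<close> is the image of \<open>(\<sigma> ^^ k) w\<close> under
      \<open>\<sigma> ^^ N\<close>, which can then be cancelled.\<close>
    define k where "k = n * N - N"
    have "n * N = N + k" using n(1) by (simp add: k_def)
    then have "w = (\<sigma> ^^ N) ((\<sigma> ^^ k) w)"
      using \<sigma>w_period[of N] by (simp add: funpow_add)
    moreover have "coeff (sum F \<D>) n = w"
      using F(3) by (simp add: coeff_sum w_def)
    ultimately have "(\<sigma> ^^ N) ((\<sigma> ^^ k) w * r) \<in> (\<sigma> ^^ N) ` P"
      using * by (simp add: sigma_pow_mult[OF aut der])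
    then have "(\<sigma> ^^ k) w * r \<in> P"
      using bij_sigma_pow[OF aut der, of N] by (auto simp: bij_def dest: injD)
    then show "r \<in> P" by (rule w_regular)
  qed
  with proper show False by blast
qed

end

theorem theorem2:
  fixes \<sigma> D :: "'a::ring \<Rightarrow> 'a"
  assumes "pi_ring TYPE('a)"
    and "ring_automorphism \<sigma>"
    and "locally_torsion \<sigma>"
    and "skew_derivation \<sigma> D"
  shows "nil_ideal {a. [:a:] \<in> jacobson_radical (ore_mult \<sigma> D)}"
proof -
  define I where "I = {a. [:a:] \<in> jacobson_radical (ore_mult \<sigma> D)}"
  have I: "two_sided_ideal (*) I"
    unfolding I_def by (rule two_sided_ideal_constants[OF assms(2,4)])
  have "nilpotent_element a" if a: "a \<in> I" for a
  proof (rule ccontr)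
    assume "\<not> nilpotent_element a"
    then obtain P where P: "prime_ideal P" "a \<notin> P"
      using exists_prime_avoiding by blast
    obtain n c u where "sparse_identity TYPE('a) n c"
      "(\<Sum>is | set is \<subseteq> {..<n} \<and> length is = n. u is * c is) = 1"
      using pi_ring_sparse_identity[OF assms(1)] by blast
    then obtain t x y where t: "\<And>x y. cap (Suc t) x y \<in> P" "cap t x y \<notin> P"
      using prime_ideal.exists_capelli[OF P(1)] by blast
    obtain z where z: "z \<in> I" "z \<notin> P" and central: "\<And>P'. prime_ideal P' \<Longrightarrow>
        (\<And>x y. cap (Suc t) x y \<in> P') \<Longrightarrow> z \<in> P' \<or> (\<forall>w. z * w - w * z \<in> P')"
      using central_element[OF P(1) t I a P(2)] by metis
    obtain k where k: "k > 0" "(\<sigma> ^^ k) z = z"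
      using assms(3) by (auto simp: locally_torsion_def)
    have "(\<sigma> ^^ i) z \<in> P \<or> (\<forall>w. (\<sigma> ^^ i) z * w - w * (\<sigma> ^^ i) z \<in> P)" for i
    proof -
      \<comment> \<open>This prime ideal satisfies the same Capelli identity because
        \<open>\<sigma>\<close> commutes with \<open>cap\<close>; the conclusion for
        \<open>z\<close> modulo \<open>P'\<close> is carried to \<open>P\<close> by the surjective
        map \<open>\<sigma> ^^ i\<close>.\<close>
      define P' where "P' = {a. (\<sigma> ^^ i) a \<in> P}"
      have "z \<in> P' \<or> (\<forall>w. z * w - w * z \<in> P')"
      proof (rule central)
        show "prime_ideal P'"
          unfolding P'_def by (rule prime_ideal_preimage[OF assms(2,4) P(1)])
        show "cap (Suc t) x y \<in> P'" for x y
          unfolding P'_def mem_Collect_eq sigma_pow_cap[OF assms(2,4)] by (rule t(1))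
      qed
      moreover have "\<exists>v. w = (\<sigma> ^^ i) v" for w
        using bij_sigma_pow[OF assms(2,4), of i] by (metis bij_pointE)
      ultimately show ?thesis
        by (simp add: P'_def sigma_pow_diff[OF assms(2,4)] sigma_pow_mult[OF assms(2,4)]) metis
    qed
    then have "z \<in> P"
      using orbit_central_imp_in_prime[OF assms(2,4) P(1) _ k] z(1) by (simp add: I_def)
    with z(2) show False by blast
  qed
  with I show ?thesis by (simp add: nil_ideal_def I_def)
qed

end
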